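(* Let $(\mathcal H, \langle \cdot, \cdot \rangle_{\mathcal H})$ and $(\mathcal V, \langle \cdot, \cdot \rangle_{\mathcal V})$ be any real separable Hilbert spaces and let $q\in[1,\infty)$. Then, for all $F\in\mathcal S_{\mathcal V}$, $$\left\|F-\mathbb E[F]\right\|_{L^q(\Omega;\mathcal V)}\le c_q\left\|DF\right\|_{L^q(\Omega;\mathcal H\otimes\mathcal V)},\qquad c_q:=\begin{cases}\sqrt{q-1} & \text{for } q\in[2,\infty),\\ \frac{\pi}{2} & \text{for } q\in[1,2).\end{cases}$$
   Context: Setting. An isonormal Gaussian process over a real separable Hilbert space $\mathcal H$ is a centered Gaussian family $W=\{W(h):h\in\mathcal H\}$ of real random variables on a probability space $(\Omega,\mathcal F,\mathbb P)$ with $\mathbb E[W(h)W(g)]=\langle h,g\rangle_{\mathcal H}$ for all $h,g\in\mathcal H$. Throughout such a $W$ is fixed and $\mathcal F$ is the $\sigma$-field generated by $\{W(h):h\in\mathcal H\}$. $\mathcal S$ is the set of random variables $F=f(W(h_1),\dots,W(h_m))$ with $m\ge1$, $h_1,\dots,h_m\in\mathcal H$ and $f\in C^\infty(\mathbb R^m)$ such that $f$ and all its partial derivatives have at most polynomial growth. The Malliavin derivative of such $F$ is the $\mathcal H$-valued random variable $$DF:=\sum_{i=1}^m\frac{\partial f}{\partial x_i}(W(h_1),\dots,W(h_m))\,h_i$$ (independent of the chosen representation). $\mathcal S_{\mathcal V}$ is the set of $\mathcal V$-valued random variables $F=\sum_{j=1}^J F_j v_j$ with $J\ge 1$, $F_j\in\mathcal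 S$, $v_j\in\mathcal V$; for such $F$, $DF:=\sum_{j=1}^J(DF_j)\otimes v_j$, which takes values in the Hilbert tensor product $\mathcal H\otimes\mathcal V$. For a real separable Hilbert space $\mathcal K$, $\|G\|_{L^q(\Omega;\mathcal K)}:=(\mathbb E[\|G\|_{\mathcal K}^q])^{1/q}$. *)

theory Defs
  imports "HOL-Probability.Probability"
begin

text \<open>Real separable Hilbert spaces are types of sort
  \<open>{real_inner, banach, second_countable_topology}\<close>. The sort \<open>banach\<close> provides completeness, and
  for metric spaces separability is the same as second countability.\<close>


section \<open>Hilbert tensor products\<close>

text \<open>The Hilbert tensor product is determined up to a unitary isomorphism that respects elementary
  tensors: it is a Hilbert space with a bilinear map from the two factors under which inner products
  of elementary tensors multiply and whose range is total.  The locale describes an arbitrary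
  realization, so no particular model of the completion of the algebraic tensor product is singled
  out.\<close>

locale hilbert_tensor_product =
  fixes tensor ::
    "'h::{real_inner, banach, second_countable_topology}
      \<Rightarrow> 'v::{real_inner, banach, second_countable_topology}
      \<Rightarrow> 't::{real_inner, banach, second_countable_topology}"
  assumes bilinear_tensor: "bilinear tensor"
    and inner_tensor: "inner (tensor h v) (tensor h' v') = inner h h' * inner v v'"
    and total_tensor: "closure (span (range (\<lambda>(h, v). tensor h v))) = UNIV"

lemma hilbert_tensor_product_scaleR:
  "hilbert_tensor_product
    (scaleR :: real \<Rightarrow> 'v \<Rightarrow> 'v::{real_inner, banach, second_countable_topology})"
proof
  show "bilinear (scaleR :: real \<Rightarrow> 'v \<Rightarrow> 'v)"
    unfolding bilinear_def by (auto intro!: linearI simp: algebra_simps)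
  show "inner (scaleR h v) (scaleR h' v') = inner h h' * inner v v'" for h h' and v v' :: 'v
    by simp
  have "v \<in> range (\<lambda>(h, v). h *\<^sub>R v)" for v :: 'v
    by (rule range_eqI[of _ _ "(1, v)"]) simp
  then have "range (\<lambda>(h, v). h *\<^sub>R v :: 'v) = UNIV" by auto
  then show "closure (span (range (\<lambda>(h, v). h *\<^sub>R v :: 'v))) = UNIV"
    by simp
qed


section \<open>Isonormal Gaussian processes\<close>

text \<open>The degenerate Gaussian law (Dirac measure at 0) has no density and is a separate case.\<close>

definition centered_gaussian :: "'a measure \<Rightarrow> ('a \<Rightarrow> real) \<Rightarrow> bool" where
  "centered_gaussian M X \<longleftrightarrow>
    X \<in> borel_measurable M \<and>
    ((AE \<omega> in M. X \<omega> = 0) \<or>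
     (\<exists>\<sigma>>0. distributed M lborel X (\<lambda>x. ennreal (normal_density 0 \<sigma> x))))"

definition centered_gaussian_family :: "'a measure \<Rightarrow> ('i \<Rightarrow> 'a \<Rightarrow> real) \<Rightarrow> bool" where
  "centered_gaussian_family M X \<longleftrightarrow>
    (\<forall>I c. finite I \<longrightarrow> centered_gaussian M (\<lambda>\<omega>. \<Sum>i\<in>I. c i * X i \<omega>))"

locale isonormal_gaussian_process = prob_space M
  for M :: "'a measure"
    and W :: "'h::{real_inner, banach, second_countable_topology} \<Rightarrow> 'a \<Rightarrow> real" +
  assumes gaussian: "centered_gaussian_family M W"
    and covariance: "expectation (\<lambda>\<omega>. W h \<omega> * W g \<omega>) = inner h g"
    and sets_generated:
      "sets M = sigma_sets (space M) {W h -` B \<inter> space M | h B. B \<in> sets borel}"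


section \<open>Smooth functions of polynomial growth\<close>

text \<open>Since the number \<open>m\<close> of variables is quantified inside the definitions below, a function on
  \<open>m\<close>-dimensional space is represented by a function on \<^typ>\<open>nat \<Rightarrow> real\<close> which only depends on the
  coordinates below \<open>m\<close>.  For such a function, continuity with respect to the product topology on
  \<^typ>\<open>nat \<Rightarrow> real\<close> is continuity as a function of the first \<open>m\<close> coordinates.\<close>

definition depends_on_first :: "nat \<Rightarrow> ((nat \<Rightarrow> real) \<Rightarrow> 'b) \<Rightarrow> bool" where
  "depends_on_first m f \<longleftrightarrow> (\<forall>x y. (\<forall>i<m. x i = y i) \<longrightarrow> f x = f y)"

definition partial_deriv :: "nat \<Rightarrow> ((nat \<Rightarrow> real) \<Rightarrow> real) \<Rightarrow> (nat \<Rightarrow> real) \<Rightarrow> real" where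
  "partial_deriv i f x = deriv (\<lambda>t. f (x(i := t))) (x i)"

definition partially_differentiable :: "nat \<Rightarrow> ((nat \<Rightarrow> real) \<Rightarrow> real) \<Rightarrow> bool" where
  "partially_differentiable i f \<longleftrightarrow>
    (\<forall>x. (\<lambda>t. f (x(i := t))) field_differentiable at (x i))"

text \<open>For a list \<open>\<alpha>\<close> of indices, \<^term>\<open>foldr partial_deriv \<alpha> f\<close> is the iterated partial derivative
  of \<open>f\<close>; the empty list gives \<open>f\<close> itself.\<close>

definition smooth_function :: "nat \<Rightarrow> ((nat \<Rightarrow> real) \<Rightarrow> real) \<Rightarrow> bool" where
  "smooth_function m f \<longleftrightarrow>
    depends_on_first m f \<and>
    (\<forall>\<alpha>\<in>lists {..<m}.
      continuous_on UNIV (foldr partial_deriv \<alpha> f) \<and>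
      (\<forall>i<m. partially_differentiable i (foldr partial_deriv \<alpha> f)))"

definition polynomial_growth :: "nat \<Rightarrow> ((nat \<Rightarrow> real) \<Rightarrow> real) \<Rightarrow> bool" where
  "polynomial_growth m f \<longleftrightarrow>
    (\<exists>C k. \<forall>x. \<bar>f x\<bar> \<le> C * (1 + L2_set x {..<m}) ^ k)"

definition smooth_polynomial_growth :: "nat \<Rightarrow> ((nat \<Rightarrow> real) \<Rightarrow> real) \<Rightarrow> bool" where
  "smooth_polynomial_growth m f \<longleftrightarrow>
    smooth_function m f \<and>
    (\<forall>\<alpha>\<in>lists {..<m}. polynomial_growth m (foldr partial_deriv \<alpha> f))"


section \<open>Smooth random variables and the Malliavin derivative\<close>

text \<open>Random variables are compared on \<^term>\<open>space M\<close> only.\<close>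

definition smooth_rv ::
  "'a measure \<Rightarrow> ('h::{real_inner, banach, second_countable_topology} \<Rightarrow> 'a \<Rightarrow> real)
    \<Rightarrow> ('a \<Rightarrow> real) set" where
  "smooth_rv M W =
    {F. \<exists>m h f. 1 \<le> m \<and> smooth_polynomial_growth m f \<and>
      (\<forall>\<omega>\<in>space M. F \<omega> = f (\<lambda>i. W (h i) \<omega>))}"

definition smooth_vector_rv ::
  "'a measure \<Rightarrow> ('h::{real_inner, banach, second_countable_topology} \<Rightarrow> 'a \<Rightarrow> real)
    \<Rightarrow> ('a \<Rightarrow> 'v::{real_inner, banach, second_countable_topology}) set" where
  "smooth_vector_rv M W =
    {F. \<exists>J F' v. 1 \<le> J \<and> (\<forall>j<J. F' j \<in> smooth_rv M W) \<and>
      (\<forall>\<omega>\<in>space M. F \<omega> = (\<Sum>j<J::nat. F' j \<omega> *\<^sub>R v j))}"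

text \<open>The Malliavin derivative does not depend on the chosen representation (almost surely), but
  this is a theorem.  It is therefore introduced as a relation between a random variable and
  its derivative, which holds if some representation of the variable yields the derivative.\<close>

definition has_malliavin_derivative ::
  "'a measure \<Rightarrow> ('h::{real_inner, banach, second_countable_topology} \<Rightarrow> 'a \<Rightarrow> real)
    \<Rightarrow> ('a \<Rightarrow> real) \<Rightarrow> ('a \<Rightarrow> 'h) \<Rightarrow> bool" where
  "has_malliavin_derivative M W F DF \<longleftrightarrow>
    (\<exists>m h f. 1 \<le> m \<and> smooth_polynomial_growth m f \<and>
      (\<forall>\<omega>\<in>space M. F \<omega> = f (\<lambda>i. W (h i) \<omega>)) \<and>
      (\<forall>\<omega>\<in>space M. DF \<omega> = (\<Sum>i<m. partial_deriv i f (\<lambda>i. W (h i) \<omega>) *\<^sub>R h i)))"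

definition has_vector_malliavin_derivative ::
  "('h \<Rightarrow> 'v \<Rightarrow> 't) \<Rightarrow> 'a measure
    \<Rightarrow> ('h::{real_inner, banach, second_countable_topology} \<Rightarrow> 'a \<Rightarrow> real)
    \<Rightarrow> ('a \<Rightarrow> 'v::{real_inner, banach, second_countable_topology})
    \<Rightarrow> ('a \<Rightarrow> 't::{real_inner, banach, second_countable_topology}) \<Rightarrow> bool" where
  "has_vector_malliavin_derivative tensor M W F DF \<longleftrightarrow>
    (\<exists>J F' DF' v. 1 \<le> J \<and> (\<forall>j<J. has_malliavin_derivative M W (F' j) (DF' j)) \<and>
      (\<forall>\<omega>\<in>space M. F \<omega> = (\<Sum>j<J::nat. F' j \<omega> *\<^sub>R v j)) \<and>
      (\<forall>\<omega>\<in>space M. DF \<omega> = (\<Sum>j<J. tensor (DF' j \<omega>) (v j))))"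

lemma smooth_rv_iff: "F \<in> smooth_rv M W \<longleftrightarrow> (\<exists>DF. has_malliavin_derivative M W F DF)"
proof
  assume "F \<in> smooth_rv M W"
  then obtain m h f where *: "1 \<le> m" "smooth_polynomial_growth m f"
    "\<forall>\<omega>\<in>space M. F \<omega> = f (\<lambda>i. W (h i) \<omega>)"
    unfolding smooth_rv_def mem_Collect_eq by (elim exE conjE)
  then show "\<exists>DF. has_malliavin_derivative M W F DF"
    unfolding has_malliavin_derivative_def
    by (intro exI[of _ "\<lambda>\<omega>. \<Sum>i<m. partial_deriv i f (\<lambda>i. W (h i) \<omega>) *\<^sub>R h i"]
      exI[of _ m] exI[of _ h] exI[of _ f]) simp
next
  assume "\<exists>DF. has_malliavin_derivative M W F DF"
  then obtain m h f where *: "1 \<le> m" "smooth_polynomial_growth m f"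
    "\<forall>\<omega>\<in>space M. F \<omega> = f (\<lambda>i. W (h i) \<omega>)"
    unfolding has_malliavin_derivative_def by (elim exE conjE)
  then show "F \<in> smooth_rv M W"
    unfolding smooth_rv_def mem_Collect_eq
    by (intro exI[of _ m] exI[of _ h] exI[of _ f]) simp
qed

lemma smooth_vector_rv_iff:
  "F \<in> smooth_vector_rv M W \<longleftrightarrow> (\<exists>DF. has_vector_malliavin_derivative tensor M W F DF)"
proof
  assume "F \<in> smooth_vector_rv M W"
  then obtain J F' v where *: "1 \<le> J" "\<forall>j<J. F' j \<in> smooth_rv M W"
    "\<forall>\<omega>\<in>space M. F \<omega> = (\<Sum>j<J::nat. F' j \<omega> *\<^sub>R v j)"
    unfolding smooth_vector_rv_def mem_Collect_eq by (elim exE conjE)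
  obtain DF' where "\<forall>j<J. has_malliavin_derivative M W (F' j) (DF' j)"
    using *(2) unfolding smooth_rv_iff by metis
  with * show "\<exists>DF. has_vector_malliavin_derivative tensor M W F DF"
    unfolding has_vector_malliavin_derivative_def
    by (intro exI[of _ "\<lambda>\<omega>. \<Sum>j<J. tensor (DF' j \<omega>) (v j)"]
      exI[of _ J] exI[of _ F'] exI[of _ DF'] exI[of _ v]) simp
next
  assume "\<exists>DF. has_vector_malliavin_derivative tensor M W F DF"
  then obtain J F' DF' v where "1 \<le> J"
    "\<forall>j<J. has_malliavin_derivative M W (F' j) (DF' j)"
    "\<forall>\<omega>\<in>space M. F \<omega> = (\<Sum>j<J::nat. F' j \<omega> *\<^sub>R v j)"
    unfolding has_vector_malliavin_derivative_def by (elim exE conjE)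
  then show "F \<in> smooth_vector_rv M W"
    unfolding smooth_vector_rv_def mem_Collect_eq smooth_rv_iff
    by (intro exI[of _ J] exI[of _ F'] exI[of _ v]) auto
qed


section \<open>The norm and the constant\<close>

text \<open>The norm takes values in \<^typ>\<open>ennreal\<close>, so that it is infinite (rather than 0, as the Bochner
  integral would make it) when the moment of order \<open>q\<close> is infinite.\<close>

definition Lq_norm :: "'a measure \<Rightarrow> real \<Rightarrow> ('a \<Rightarrow> 'k::real_normed_vector) \<Rightarrow> ennreal" where
  "Lq_norm M q G =
    (let I = \<integral>\<^sup>+ \<omega>. ennreal (norm (G \<omega>) powr q) \<partial>M
     in if I = \<infinity> then \<infinity> else ennreal (enn2real I powr (1 / q)))"

definition poincare_const :: "real \<Rightarrow> real" where
  "poincare_const q = (if 2 \<le> q then sqrt (q - 1) else pi / 2)"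

end

theory Submission
  imports Defs
begin

text \<open>Finitely many of the variables \<open>W h\<close> enter the random variable; as members of one Gaussian
  sequence they make it a function \<open>\<Phi>\<close> of that sequence.  Let \<open>\<mu>\<close> be the law of that sequence on \<open>nat \<Rightarrow> real\<close>, and let \<open>x\<close>, \<open>y\<close> be two
  independent copies.  The joint law of \<open>x\<close> and \<open>y\<close> is invariant under the rotations
  \<open>(x, y) \<mapsto> (cos \<theta> x + sin \<theta> y, - sin \<theta> x + cos \<theta> y)\<close>: both sides have the same characteristic
  function, and characteristic functions determine laws (lemmas \<open>Levy_uniqueness_countable_family\<close> and
  \<open>rotation_invariant_pair\<close>).  The analysis below rests on this invariance and on finite moments, which
  are the assumptions of the locale \<open>rotation_invariant\<close>.  The covariance of the sequence enters once
  more, to see that the norm of the Malliavin derivative at \<open>x\<close> is the root mean square, over an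
  independent copy \<open>z\<close>, of the directional derivative \<open>d\<Phi> x z\<close>; this quantity is called \<open>gradient_norm\<close>.
  Write \<open>x\<^sub>\<theta> = cos \<theta> x + sin \<theta> y\<close>; its derivative in \<open>\<theta>\<close> is \<open>x\<^sub>\<theta>'\<close>, the second component of
  the rotated pair.

  For \<open>q \<le> 2\<close> the argument is Pisier's.  Since \<open>\<Phi> y - \<Phi> x\<close> is the integral of \<open>d\<Phi> x\<^sub>\<theta> x\<^sub>\<theta>'\<close>
  over \<open>\<theta>\<close> from \<open>0\<close> to \<open>\<pi> / 2\<close>, and the pair \<open>(x\<^sub>\<theta>, x\<^sub>\<theta>')\<close> has the law of \<open>(x, y)\<close> for each \<open>\<theta>\<close>,
  Jensen's inequality bounds the \<open>q\<close>-th moment of \<open>\<Phi> y - \<Phi> x\<close>, and with it that of \<open>\<Phi>\<close> minus its mean,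
  by \<open>(\<pi> / 2)\<^sup>q\<close> times that of \<open>d\<Phi> x y\<close>.  As \<open>q \<le> 2\<close>, the conditional \<open>q\<close>-th moment of \<open>d\<Phi> x y\<close> given
  \<open>x\<close> is at most the \<open>q\<close>-th power of the gradient norm at \<open>x\<close> (lemmas \<open>moment_deviation_le_pair\<close>,
  \<open>pair_difference_moment_le\<close> and \<open>directional_moment_le\<close>).

  For \<open>q \<ge> 2\<close> the same path yields the covariance of two functions \<open>\<Phi>\<close> and \<open>\<Gamma>\<close> as the integral over
  \<open>\<theta>\<close> of \<open>sin \<theta>\<close> times the expectation of \<open>d\<Phi> x\<^sub>-\<^sub>\<theta> z \<bullet> d\<Gamma> x z\<close> with a third independent copy \<open>z\<close>
  (lemmas \<open>covariance_rotation\<close> and \<open>integration_by_parts\<close>).  Apply it to a centred \<open>\<Phi>\<close> and to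
  \<open>\<Gamma> = |\<Phi>|\<^sup>q\<^sup>-\<^sup>2 \<Phi>\<close>.  The covariance is then the \<open>q\<close>-th moment \<open>N\<close> of \<open>\<Phi>\<close>, and \<open>d\<Gamma>\<close> is bounded by
  \<open>(q - 1) |\<Phi>|\<^sup>q\<^sup>-\<^sup>2\<close> times \<open>d\<Phi>\<close>.  Young's inequality turns the bound into
  \<open>N \<le> (1 - 2 / q) N + (2 / q) (q - 1)\<^sup>q\<^sup>/\<^sup>2 d\<close>, where \<open>d\<close> is the \<open>q\<close>-th moment of the gradient norm,
  and solving for \<open>N\<close> gives the constant \<open>sqrt (q - 1)\<close> (lemma \<open>poincare_ge_2_centered\<close>).\<close>

section \<open>Uniqueness of the law of a countable family\<close>

text \<open>Levy's theorem for probability measures extends to finite measures: the value of the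
  characteristic function at \<open>0\<close> is the total mass, by which both measures can be divided unless they
  vanish.\<close>

lemma finite_measure_eqI_char:
  fixes P Q :: "real measure"
  assumes P: "finite_measure P" "sets P = sets borel"
    and Q: "finite_measure Q" "sets Q = sets borel"
    and char: "\<And>s. (CLINT x|P. iexp (s * x)) = (CLINT x|Q. iexp (s * x))"
  shows "P = Q"
proof -
  interpret P: finite_measure P by fact
  interpret Q: finite_measure Q by fact
  note [measurable_cong] = P(2) Q(2)
  have sp [simp]: "space P = UNIV" "space Q = UNIV"
    using sets_eq_imp_space_eq[OF P(2)] sets_eq_imp_space_eq[OF Q(2)] by auto
  define m where "m = measure P UNIV"
  have mQ: "measure Q UNIV = m"
    using char[of 0] by (simp add: m_def)
  have eP: "emeasure P UNIV = ennreal m" and eQ: "emeasure Q UNIV = ennreal m"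
    using mQ by (auto simp: m_def P.emeasure_eq_measure Q.emeasure_eq_measure)
  show ?thesis
  proof (cases "m = 0")
    case True
    have "emeasure P A = 0" "emeasure Q A = 0" for A
      using emeasure_space[of P A] emeasure_space[of Q A] eP eQ True by auto
    then show ?thesis by (intro measure_eqI) (auto simp: P(2) Q(2))
  next
    case False
    then have m: "m > 0" by (simp add: m_def zero_less_measure_iff)
    define N where "N R = density R (\<lambda>_. ennreal (1 / m))" for R :: "real measure"
    have em: "emeasure (N R) A = ennreal (1 / m) * emeasure R A" if "A \<in> sets R" for R A
      using that by (simp add: N_def emeasure_density nn_integral_cmult_indicator)
    have dist: "real_distribution (N P)" "real_distribution (N Q)"
      unfolding real_distribution_def real_distribution_axioms_def
      using m em[of UNIV P] em[of UNIV Q] eP eQ P(2) Q(2)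
      by (auto intro!: prob_spaceI simp: N_def simp flip: ennreal_mult)
    have "char (N P) = char (N Q)"
      using char m by (auto simp: char_def N_def integral_density fun_eq_iff)
    from Levy_uniqueness[OF dist this] have eq: "N P = N Q" .
    show ?thesis
    proof (rule measure_eqI)
      fix A assume A: "A \<in> sets P"
      then have "ennreal (1 / m) * emeasure P A = ennreal (1 / m) * emeasure Q A"
        using em[of A P] em[of A Q] eq P(2) Q(2) by auto
      then show "emeasure P A = emeasure Q A"
        using m by (simp add: ennreal_mult_cancel_left)
    qed (simp add: P(2) Q(2))
  qed
qed

text \<open>Induction on the number of coordinates reduces the claim to one dimension.  Let \<open>u\<close> be a linear
  form in the coordinates other than \<open>k\<close>.  The weights \<open>2 + cos (u + \<phi>)\<close> are nonnegative, and the
  characteristic function of the coordinate \<open>k\<close> under the weighted measures is a combination of values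
  of the joint one.  By the one-dimensional theorem, the integrals of
  \<open>indicator {x. x k \<in> A k} * (2 + cos (u + \<phi>))\<close> agree; the choices \<open>\<phi> = 0\<close> and \<open>\<phi> = - \<pi> / 2\<close> recover
  the integral of \<open>iexp u\<close>.  So the two measures restricted to \<open>{x. x k \<in> A k}\<close> have the same
  characteristic function in the remaining coordinates.\<close>

lemma measure_box_eqI_char:
  fixes P Q :: "('i \<Rightarrow> real) measure"
  assumes "finite K" "finite_measure P" "finite_measure Q"
    and "sets P = sets (PiM UNIV (\<lambda>_. borel))" "sets Q = sets (PiM UNIV (\<lambda>_. borel))"
    and "\<And>t. (CLINT x|P. iexp (\<Sum>i\<in>K. t i * x i)) = (CLINT x|Q. iexp (\<Sum>i\<in>K. t i * x i))"
    and "\<And>i. A i \<in> sets borel"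
  shows "emeasure P {x. \<forall>i\<in>K. x i \<in> A i} = emeasure Q {x. \<forall>i\<in>K. x i \<in> A i}"
  using assms
proof (induction K arbitrary: P Q rule: finite_induct)
  case empty
  interpret P: finite_measure P by fact
  interpret Q: finite_measure Q by fact
  have [simp]: "space P = UNIV" "space Q = UNIV"
    using sets_eq_imp_space_eq[OF empty(3)] sets_eq_imp_space_eq[OF empty(4)]
    by (auto simp: space_PiM)
  show ?case using empty(5) by (simp add: P.emeasure_eq_measure Q.emeasure_eq_measure)
next
  case (insert k K)
  interpret P: finite_measure P by fact
  interpret Q: finite_measure Q by fact
  note [measurable_cong] = insert.prems(3,4)
  note A[measurable] = insert.prems(6)
  have sp[simp]: "space P = UNIV" "space Q = UNIV"
    using sets_eq_imp_space_eq[OF insert.prems(3)] sets_eq_imp_space_eq[OF insert.prems(4)]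
    by (auto simp: space_PiM)
  define u where "u t x = (\<Sum>i\<in>K. t i * x i)" for t x :: "'i \<Rightarrow> real"
  define w where "w t \<phi> x = 2 + cos (u t x + \<phi>)" for t \<phi> x
  have w_pos: "0 \<le> w t \<phi> x" for t \<phi> x
    unfolding w_def using cos_ge_minus_one[of "u t x + \<phi>"] by linarith
  have w_le: "w t \<phi> x \<le> 3" for t \<phi> x
    unfolding w_def using cos_le_one[of "u t x + \<phi>"] by linarith
  have u_meas [measurable]: "u t \<in> borel_measurable (PiM UNIV (\<lambda>_. borel))" for t
    unfolding u_def by measurable
  have w_meas [measurable]: "w t \<phi> \<in> borel_measurable (PiM UNIV (\<lambda>_. borel))" for t \<phi>
    unfolding w_def by measurable
  \<comment> \<open>Testing against \<open>iexp\<close> of the coordinate \<open>k\<close>, the weight splits into three exponentials.\<close>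
  have split: "iexp (s * x k) * of_real (w t \<phi> x) =
      2 * iexp (s * x k + 0) + (iexp \<phi> / 2) * iexp (s * x k + u t x)
        + (iexp (- \<phi>) / 2) * iexp (s * x k - u t x)" for s t \<phi> x
    unfolding w_def of_real_add cos_of_real[symmetric] cos_exp_eq
    by (simp add: field_simps exp_add exp_diff exp_minus)
  have joint: "(CLINT x|P. iexp (s * x k + u t x)) = (CLINT x|Q. iexp (s * x k + u t x))" for s t
  proof -
    have "s * x k + u t x = (\<Sum>i\<in>insert k K. (t(k := s)) i * x i)" for x
      using insert.hyps by (auto simp: u_def intro!: sum.cong)
    then show ?thesis by (simp only: insert.prems(5))
  qed
  have joint': "(CLINT x|P. iexp (s * x k - u t x)) = (CLINT x|Q. iexp (s * x k - u t x))"
      "(CLINT x|P. iexp (s * x k + 0)) = (CLINT x|Q. iexp (s * x k + 0))" for s t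
    using joint[of s "\<lambda>i. - t i"] joint[of s "\<lambda>i. 0"] by (simp_all add: u_def sum_negf)
  have iexp_int: "integrable R (\<lambda>x. iexp (f x))"
    if "finite_measure R" "f \<in> borel_measurable R" for R :: "('i \<Rightarrow> real) measure" and f
    using that by (intro finite_measure.integrable_const_bound[where B=1]) auto
  have weighted_split: "(CLINT x|R. iexp (s * x k) * of_real (w t \<phi> x)) =
      2 * (CLINT x|R. iexp (s * x k + 0)) + (iexp \<phi> / 2) * (CLINT x|R. iexp (s * x k + u t x))
        + (iexp (- \<phi>) / 2) * (CLINT x|R. iexp (s * x k - u t x))"
    if R: "finite_measure R" and S[measurable_cong]: "sets R = sets (PiM UNIV (\<lambda>_. borel))"
    for R s t \<phi>
  proof -
    have "integrable R (\<lambda>x. iexp (s * x k + 0))" "integrable R (\<lambda>x. iexp (s * x k + u t x))"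
      "integrable R (\<lambda>x. iexp (s * x k - u t x))"
      by (rule iexp_int[OF R]; measurable)+
    then show ?thesis
      unfolding split by (simp del: add_0_right)
  qed
  have weighted: "(CLINT x|P. iexp (s * x k) * of_real (w t \<phi> x)) =
      (CLINT x|Q. iexp (s * x k) * of_real (w t \<phi> x))" for s t \<phi>
    by (simp only: weighted_split[OF insert.prems(1,3)] weighted_split[OF insert.prems(2,4)]
        joint joint')
  define V where "V R t \<phi> = distr (density R (\<lambda>x. ennreal (w t \<phi> x))) borel (\<lambda>x. x k)"
    for R :: "('i \<Rightarrow> real) measure" and t \<phi>
  have fin: "finite_measure (V R t \<phi>)"
    if "finite_measure R" and [measurable_cong]: "sets R = sets (PiM UNIV (\<lambda>_. borel))" for R t \<phi>
  proof -
    interpret R: finite_measure R by fact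
    have "(\<integral>\<^sup>+x. ennreal (w t \<phi> x) \<partial>R) \<le> (\<integral>\<^sup>+x. 3 \<partial>R)"
      using w_le by (intro nn_integral_mono) (simp add: ennreal_leI flip: ennreal_numeral)
    also have "\<dots> < \<infinity>" using R.emeasure_finite[of "space R"]
      by (simp add: ennreal_mult_eq_top_iff less_top[symmetric])
    finally have "finite_measure (density R (\<lambda>x. ennreal (w t \<phi> x)))"
      by (intro finite_measureI) (auto simp: emeasure_density)
    then show ?thesis unfolding V_def by (rule finite_measure.finite_measure_distr) measurable
  qed
  have V_char: "(CLINT x|V R t \<phi>. iexp (s * x)) = (CLINT x|R. iexp (s * x k) * of_real (w t \<phi> x))"
    if [measurable_cong]: "sets R = sets (PiM UNIV (\<lambda>_. borel))" for R s t \<phi>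
    unfolding V_def using w_pos
    by (subst integral_distr, measurable, subst integral_density)
       (auto simp: scaleR_conv_of_real mult.commute)
  have V_eq: "V P t \<phi> = V Q t \<phi>" for t \<phi>
    by (rule finite_measure_eqI_char)
       (use fin insert.prems weighted V_char in \<open>auto simp: V_def\<close>)
  define a where "a x = (indicator (A k) (x k) :: real)" for x :: "'i \<Rightarrow> real"
  have a_meas [measurable]: "a \<in> borel_measurable (PiM UNIV (\<lambda>_. borel))"
    unfolding a_def by measurable
  have V_int: "(LINT x|R. a x * w t \<phi> x) = measure (V R t \<phi>) (A k)"
    if [measurable_cong]: "sets R = sets (PiM UNIV (\<lambda>_. borel))" for R t \<phi>
  proof -
    have "measure (V R t \<phi>) (A k) = (LINT x|V R t \<phi>. indicator (A k) x)"
      by (simp add: V_def)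
    also have "\<dots> = (LINT x|R. a x * w t \<phi> x)"
      unfolding V_def using w_pos
      by (subst integral_distr, measurable, subst integral_density)
         (auto simp: mult.commute a_def)
    finally show ?thesis by simp
  qed
  have aw: "(LINT x|P. a x * w t \<phi> x) = (LINT x|Q. a x * w t \<phi> x)" for t \<phi>
    by (simp only: V_int[OF insert.prems(3)] V_int[OF insert.prems(4)] V_eq)
  have a_le: "\<bar>a x\<bar> \<le> 1" for x by (simp add: a_def indicator_def)
  have a_int: "integrable R (\<lambda>x. a x * f x)"
    if "finite_measure R" and [measurable_cong]: "sets R = sets (PiM UNIV (\<lambda>_. borel))"
      and "f \<in> borel_measurable R" "\<And>x. \<bar>f x\<bar> \<le> 3" for R f
    using that mult_mono[OF a_le, of _ 3]
    by (intro finite_measure.integrable_const_bound[where B=3]) (auto simp: abs_mult)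
  have a_eq: "(LINT x|P. a x) = (LINT x|Q. a x)"
    using aw[of "\<lambda>_. 0" 0] by (simp add: w_def u_def)
  have a_cos: "(LINT x|P. a x * cos (u t x + \<phi>)) = (LINT x|Q. a x * cos (u t x + \<phi>))" for t \<phi>
  proof -
    have *: "(LINT x|R. a x * cos (u t x + \<phi>)) = (LINT x|R. a x * w t \<phi> x) - 2 * (LINT x|R. a x)"
      if R: "finite_measure R" and S[measurable_cong]: "sets R = sets (PiM UNIV (\<lambda>_. borel))" for R
    proof -
      have "(LINT x|R. a x * cos (u t x + \<phi>)) = (LINT x|R. a x * w t \<phi> x - 2 * a x)"
        by (intro Bochner_Integration.integral_cong) (auto simp: w_def algebra_simps)
      also have "\<dots> = (LINT x|R. a x * w t \<phi> x) - (LINT x|R. 2 * a x)"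
      proof (rule Bochner_Integration.integral_diff)
        show "integrable R (\<lambda>x. a x * w t \<phi> x)"
          by (rule a_int[OF R S]) (use w_pos w_le in \<open>auto\<close>)
        show "integrable R (\<lambda>x. 2 * a x)"
          using a_int[OF R S, of "\<lambda>_. 2"] by (simp add: mult.commute)
      qed
      finally show ?thesis by simp
    qed
    show ?thesis using *[of P] *[of Q] insert.prems aw a_eq by simp
  qed
  have a_char: "(CLINT x|R. of_real (a x) * iexp (u t x)) =
      of_real (LINT x|R. a x * cos (u t x + 0)) + \<i> * of_real (LINT x|R. a x * cos (u t x + (- pi / 2)))"
    if R: "finite_measure R" and S[measurable_cong]: "sets R = sets (PiM UNIV (\<lambda>_. borel))" for R t
  proof -
    have eq: "of_real (a x) * iexp (u t x) =
        of_real (a x * cos (u t x + 0)) + \<i> * of_real (a x * cos (u t x + (- pi / 2)))" for x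
      by (simp add: cos_add cos_diff cis_conv_exp[symmetric] complex_eq_iff)
    have *: "integrable R (\<lambda>x. a x * cos (u t x + \<phi>))" for \<phi>
      by (rule a_int[OF R S]) (auto intro: order_trans[OF abs_cos_le_one])
    show ?thesis unfolding eq using *[of 0] *[of "- pi / 2"]
      by (subst Bochner_Integration.integral_add) (auto simp del: add_0_right of_real_mult)
  qed
  define B where "B = {x :: 'i \<Rightarrow> real. x k \<in> A k}"
  have B [measurable]: "B \<in> sets (PiM UNIV (\<lambda>_. borel))"
    unfolding B_def using measurable_sets[of "\<lambda>x. x k" "PiM UNIV (\<lambda>_. borel)" borel "A k"]
    by (auto simp: vimage_def space_PiM)
  have fin': "finite_measure (density R (indicator B))"
    if "finite_measure R" and [measurable_cong]: "sets R = sets (PiM UNIV (\<lambda>_. borel))" for R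
  proof -
    interpret R: finite_measure R by fact
    show ?thesis
      by (intro finite_measureI) (auto simp: emeasure_density)
  qed
  have dens_char: "(CLINT x|density R (indicator B). iexp (\<Sum>i\<in>K. t i * x i)) =
      (CLINT x|R. of_real (a x) * iexp (u t x))"
    if [measurable_cong]: "sets R = sets (PiM UNIV (\<lambda>_. borel))" for R t
  proof -
    have "density R (indicator B) = density R (\<lambda>x. ennreal (a x))"
      by (rule arg_cong[where f = "density R"]) (auto simp: a_def B_def indicator_def)
    then show ?thesis unfolding u_def[symmetric]
      by (simp only:) (subst integral_density, auto simp: scaleR_conv_of_real a_def)
  qed
  have "emeasure (density P (indicator B)) {x. \<forall>i\<in>K. x i \<in> A i} =
      emeasure (density Q (indicator B)) {x. \<forall>i\<in>K. x i \<in> A i}"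
  proof (rule insert.IH)
    show "(CLINT x|density P (indicator B). iexp (\<Sum>i\<in>K. t i * x i)) =
        (CLINT x|density Q (indicator B). iexp (\<Sum>i\<in>K. t i * x i))" for t
      by (simp only: dens_char[OF insert.prems(3)] dens_char[OF insert.prems(4)]
          a_char[OF insert.prems(1,3)] a_char[OF insert.prems(2,4)] a_cos)
  qed (use insert.prems fin' in auto)
  moreover have K: "{x. \<forall>i\<in>K. x i \<in> A i} \<in> sets (PiM UNIV (\<lambda>_. borel))"
  proof -
    have "{x \<in> space (PiM UNIV (\<lambda>_. borel)). \<forall>i\<in>K. x i \<in> A i} \<in> sets (PiM UNIV (\<lambda>_::'i. borel))"
      using insert.hyps(1) by measurable
    then show ?thesis by (simp add: space_PiM)
  qed
  moreover have "B \<inter> {x. \<forall>i\<in>K. x i \<in> A i} = {x. \<forall>i\<in>insert k K. x i \<in> A i}"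
    by (auto simp: B_def)
  ultimately show ?case
    using insert.prems(3,4) B by (simp add: emeasure_restricted)
qed

text \<open>The boxes treated above generate the product \<open>\<sigma>\<close>-algebra, which for a countable index type is the
  Borel \<open>\<sigma>\<close>-algebra.\<close>

theorem Levy_uniqueness_countable_family:
  fixes P Q :: "('i::countable \<Rightarrow> real) measure"
  assumes P: "finite_measure P" "sets P = sets borel"
    and Q: "finite_measure Q" "sets Q = sets borel"
    and char: "\<And>K t. finite K \<Longrightarrow>
      (CLINT x|P. iexp (\<Sum>i\<in>K. t i * x i)) = (CLINT x|Q. iexp (\<Sum>i\<in>K. t i * x i))"
  shows "P = Q"
proof (rule measure_eqI_PiM_infinite)
  show PP: "sets P = sets (PiM UNIV (\<lambda>_. borel))" and QQ: "sets Q = sets (PiM UNIV (\<lambda>_. borel))"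
    using P Q by (simp_all add: sets_PiM_equal_borel)
  show "finite_measure P" by fact
  fix A and K :: "'i set" assume K: "finite K" "\<And>i. i \<in> K \<Longrightarrow> A i \<in> sets (borel :: real measure)"
  define A' where "A' i = (if i \<in> K then A i else UNIV)" for i
  have "prod_emb UNIV (\<lambda>_. borel) K (Pi\<^sub>E K A) = {x. \<forall>i\<in>K. x i \<in> A' i}"
    by (auto simp: prod_emb_def A'_def space_PiM PiE_iff extensional_def)
  then show "emeasure P (prod_emb UNIV (\<lambda>_. borel) K (Pi\<^sub>E K A)) =
      emeasure Q (prod_emb UNIV (\<lambda>_. borel) K (Pi\<^sub>E K A))"
    using measure_box_eqI_char[of K P Q A'] K P Q PP QQ char by (auto simp: A'_def)
qed

section \<open>Rotations of two independent Gaussian families\<close>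

text \<open>The second component of the rotated pair is the first one at the angle \<open>\<theta> + \<pi> / 2\<close>, which is also
  its derivative in \<open>\<theta>\<close>.  A single function therefore describes the rotation and its velocity.\<close>

definition rotated :: "real \<Rightarrow> ('i \<Rightarrow> real) \<Rightarrow> ('i \<Rightarrow> real) \<Rightarrow> 'i \<Rightarrow> real" where
  "rotated \<theta> x y = (\<lambda>i. cos \<theta> * x i + sin \<theta> * y i)"

lemma rotated_measurable [measurable]:
  fixes f g :: "'a \<Rightarrow> 'i::countable \<Rightarrow> real"
  assumes [measurable]: "t \<in> borel_measurable M" "f \<in> borel_measurable M" "g \<in> borel_measurable M"
  shows "(\<lambda>z. rotated (t z) (f z) (g z)) \<in> borel_measurable M"
proof (rule measurable_coordinatewise_then_product)
  fix i
  have [measurable]: "(\<lambda>z. f z i) \<in> borel_measurable M" "(\<lambda>z. g z i) \<in> borel_measurable M"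
    using assms by (auto intro: measurable_product_then_coordinatewise)
  show "(\<lambda>z. rotated (t z) (f z) (g z) i) \<in> borel_measurable M"
    unfolding rotated_def by measurable
qed

text \<open>A rotation of the pair acts on the coefficients \<open>(a, b)\<close> of a linear form by the transposed
  rotation, which preserves the exponent \<open>norm u ^ 2 + norm v ^ 2\<close> of the joint characteristic
  function; here \<open>u\<close> and \<open>v\<close> are the combinations of the vectors \<open>h i\<close> with coefficients \<open>a\<close> and \<open>b\<close>.
  The pair is identified with one family over the index type \<open>'i + 'i\<close>, to which the uniqueness
  theorem applies.\<close>

lemma rotation_invariant_pair:
  fixes \<mu> :: "('i::countable \<Rightarrow> real) measure" and h :: "'i \<Rightarrow> 'h::real_inner"
  assumes "prob_space \<mu>" and S [measurable_cong]: "sets \<mu> = sets borel"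
    and char: "\<And>K t. finite K \<Longrightarrow> (CLINT x|\<mu>. iexp (\<Sum>i\<in>K. t i * x i)) =
      of_real (exp (- (norm (\<Sum>i\<in>K. t i *\<^sub>R h i))\<^sup>2 / 2))"
  shows "distr (\<mu> \<Otimes>\<^sub>M \<mu>) (borel \<Otimes>\<^sub>M borel) (\<lambda>(x, y). (rotated \<theta> x y, rotated (\<theta> + pi / 2) x y))
    = \<mu> \<Otimes>\<^sub>M \<mu>"
proof -
  interpret \<mu>: prob_space \<mu> by fact
  interpret P: pair_prob_space \<mu> \<mu> ..
  let ?P = "\<mu> \<Otimes>\<^sub>M \<mu>"
  have SP: "sets ?P = sets (borel \<Otimes>\<^sub>M borel)"
    using S by (rule sets_pair_measure_cong[OF _ S])
  define rot where "rot = (\<lambda>(x, y). (rotated \<theta> x y, rotated (\<theta> + pi / 2) x y :: 'i \<Rightarrow> real))"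
  have rot_meas [measurable]: "rot \<in> ?P \<rightarrow>\<^sub>M borel \<Otimes>\<^sub>M borel"
    unfolding rot_def by measurable
  have coord [measurable]: "(\<lambda>x. x i) \<in> borel_measurable \<mu>" for i
    unfolding measurable_cong_sets[OF S refl] by (rule measurable_product_coordinates)
  have pair_char: "(CLINT p|?P. iexp ((\<Sum>i\<in>K. a i * fst p i) + (\<Sum>i\<in>K. b i * snd p i))) =
      of_real (exp (- ((norm (\<Sum>i\<in>K. a i *\<^sub>R h i))\<^sup>2 + (norm (\<Sum>i\<in>K. b i *\<^sub>R h i))\<^sup>2) / 2))"
    if K: "finite K" for K a b
  proof -
    define f where "f a x = iexp (\<Sum>i\<in>K. a i * x i)" for a x :: "'i \<Rightarrow> real"
    have [measurable]: "f a \<in> borel_measurable \<mu>" for a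
      unfolding f_def by measurable
    have "(CLINT p|?P. iexp ((\<Sum>i\<in>K. a i * fst p i) + (\<Sum>i\<in>K. b i * snd p i))) =
        (CLINT p|?P. f a (fst p) * f b (snd p))"
      unfolding f_def by (intro Bochner_Integration.integral_cong) (auto simp: exp_add algebra_simps)
    also have "\<dots> = (CLINT x|\<mu>. CLINT y|\<mu>. f a x * f b y)"
      by (subst P.integral_fst'[symmetric])
         (auto intro!: P.P.integrable_const_bound[where B=1] simp: f_def norm_mult)
    also have "\<dots> = (CLINT x|\<mu>. f a x) * (CLINT y|\<mu>. f b y)"
      by simp
    finally show ?thesis
      using char[OF K] unfolding f_def
      by (simp only: of_real_mult[symmetric] exp_add[symmetric]) (simp add: add_divide_distrib)
  qed
  define I where "I = (\<lambda>(x, y). case_sum x y :: 'i + 'i \<Rightarrow> real)"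
  define J where "J z = (\<lambda>i. z (Inl i), \<lambda>i. z (Inr i))" for z :: "'i + 'i \<Rightarrow> real"
  have I_meas [measurable]: "I \<in> borel \<Otimes>\<^sub>M borel \<rightarrow>\<^sub>M borel"
  proof (rule measurable_coordinatewise_then_product)
    fix k :: "'i + 'i"
    show "(\<lambda>p. I p k) \<in> borel_measurable (borel \<Otimes>\<^sub>M borel)"
      unfolding I_def by (cases k) (auto simp: split_beta')
  qed
  have J_meas [measurable]: "J \<in> borel \<rightarrow>\<^sub>M borel \<Otimes>\<^sub>M borel"
    unfolding J_def by (intro measurable_Pair measurable_coordinatewise_then_product) auto
  have JI: "J (I p) = p" for p
    by (auto simp: I_def J_def split: prod.split)
  have "distr ?P borel (\<lambda>p. I (rot p)) = distr ?P borel I"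
  proof (rule Levy_uniqueness_countable_family)
    show "finite_measure (distr ?P borel (\<lambda>p. I (rot p)))" "finite_measure (distr ?P borel I)"
      by (rule P.P.finite_measure_distr; measurable)+
    fix K :: "('i + 'i) set" and t :: "'i + 'i \<Rightarrow> real" assume K: "finite K"
    define L where "L = {i. Inl i \<in> K} \<union> {i. Inr i \<in> K}"
    have fin: "finite {i. Inl i \<in> K}" "finite {i. Inr i \<in> K}"
      using K finite_vimageI[OF K, of Inl] finite_vimageI[OF K, of Inr] by (auto simp: vimage_def)
    then have L: "finite L" by (simp add: L_def)
    define a b where "a i = (if Inl i \<in> K then t (Inl i) else 0)"
      and "b i = (if Inr i \<in> K then t (Inr i) else 0)" for i
    have K_eq: "K = {i. Inl i \<in> K} <+> {i. Inr i \<in> K}"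
      by (auto simp: Plus_def image_iff) (metis sum.exhaust)
    have sum_eq: "(\<Sum>k\<in>K. t k * I p k) = (\<Sum>i\<in>L. a i * fst p i) + (\<Sum>i\<in>L. b i * snd p i)" for p
    proof -
      have "(\<Sum>k\<in>K. t k * I p k) = (\<Sum>i | Inl i \<in> K. t (Inl i) * fst p i) + (\<Sum>i | Inr i \<in> K. t (Inr i) * snd p i)"
        by (subst K_eq, subst sum.Plus[OF fin]) (simp add: I_def split_beta)
      also have "(\<Sum>i | Inl i \<in> K. t (Inl i) * fst p i) = (\<Sum>i\<in>L. a i * fst p i)"
        by (rule sum.mono_neutral_cong_left) (auto simp: L a_def L_def[symmetric], auto simp: L_def)
      also have "(\<Sum>i | Inr i \<in> K. t (Inr i) * snd p i) = (\<Sum>i\<in>L. b i * snd p i)"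
        by (rule sum.mono_neutral_cong_left) (auto simp: L b_def L_def[symmetric], auto simp: L_def)
      finally show ?thesis .
    qed
    define c s where "c = cos \<theta>" and "s = sin \<theta>"
    have cs: "c\<^sup>2 + s\<^sup>2 = 1" by (simp add: c_def s_def)
    have rot_sum: "(\<Sum>i\<in>L. a i * fst (rot p) i) + (\<Sum>i\<in>L. b i * snd (rot p) i) =
        (\<Sum>i\<in>L. (c * a i - s * b i) * fst p i) + (\<Sum>i\<in>L. (s * a i + c * b i) * snd p i)" for p
      unfolding sum.distrib[symmetric]
      by (intro sum.cong)
         (auto simp: rot_def rotated_def split_beta cos_add sin_add c_def s_def algebra_simps)
    define u v where "u = (\<Sum>i\<in>L. a i *\<^sub>R h i)" and "v = (\<Sum>i\<in>L. b i *\<^sub>R h i)"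
    have uv: "(\<Sum>i\<in>L. (c * a i - s * b i) *\<^sub>R h i) = c *\<^sub>R u - s *\<^sub>R v"
        "(\<Sum>i\<in>L. (s * a i + c * b i) *\<^sub>R h i) = s *\<^sub>R u + c *\<^sub>R v"
      by (simp_all add: u_def v_def scaleR_sum_right sum.distrib sum_subtractf scaleR_left_distrib
          scaleR_left_diff_distrib)
    have "(norm (c *\<^sub>R u - s *\<^sub>R v))\<^sup>2 + (norm (s *\<^sub>R u + c *\<^sub>R v))\<^sup>2 = (c\<^sup>2 + s\<^sup>2) * (norm u)\<^sup>2 + (c\<^sup>2 + s\<^sup>2) * (norm v)\<^sup>2"
      by (simp only: power2_norm_eq_inner) (simp add: inner_commute algebra_simps power2_eq_square)
    then have norm_eq: "(norm (c *\<^sub>R u - s *\<^sub>R v))\<^sup>2 + (norm (s *\<^sub>R u + c *\<^sub>R v))\<^sup>2 = (norm u)\<^sup>2 + (norm v)\<^sup>2"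
      by (simp add: cs)
    have "(CLINT z|distr ?P borel (\<lambda>p. I (rot p)). iexp (\<Sum>k\<in>K. t k * z k)) =
        (CLINT p|?P. iexp (\<Sum>k\<in>K. t k * I (rot p) k))"
      by (subst integral_distr) (auto simp del: of_real_sum)
    also have "\<dots> = (CLINT p|?P. iexp (\<Sum>k\<in>K. t k * I p k))"
      unfolding sum_eq rot_sum pair_char[OF L] uv u_def[symmetric] v_def[symmetric] norm_eq ..
    also have "\<dots> = (CLINT z|distr ?P borel I. iexp (\<Sum>k\<in>K. t k * z k))"
      by (subst integral_distr) (auto simp del: of_real_sum)
    finally show "(CLINT z|distr ?P borel (\<lambda>p. I (rot p)). iexp (\<Sum>k\<in>K. t k * z k)) =
        (CLINT z|distr ?P borel I. iexp (\<Sum>k\<in>K. t k * z k))" .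
  qed simp_all
  then have "distr (distr ?P borel (\<lambda>p. I (rot p))) (borel \<Otimes>\<^sub>M borel) J =
      distr (distr ?P borel I) (borel \<Otimes>\<^sub>M borel) J" by simp
  then have "distr ?P (borel \<Otimes>\<^sub>M borel) rot = distr ?P (borel \<Otimes>\<^sub>M borel) (\<lambda>p. p)"
    by (simp add: distr_distr comp_def JI)
  also have "\<dots> = ?P"
    by (rule distr_id2[OF SP[symmetric]])
  finally show ?thesis unfolding rot_def .
qed

context prob_space begin

lemma centered_gaussian_integrable_power:
  assumes "centered_gaussian M X"
  shows "integrable M (\<lambda>\<omega>. \<bar>X \<omega>\<bar> ^ p)"
proof -
  have [measurable]: "X \<in> borel_measurable M"
    using assms by (simp add: centered_gaussian_def)
  consider "AE \<omega> in M. X \<omega> = 0"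
    | \<sigma> where "\<sigma> > 0" "distributed M lborel X (\<lambda>x. ennreal (normal_density 0 \<sigma> x))"
    using assms by (auto simp: centered_gaussian_def)
  then show ?thesis
  proof cases
    case 1
    then have "integrable M (\<lambda>\<omega>. \<bar>X \<omega>\<bar> ^ p) \<longleftrightarrow> integrable M (\<lambda>\<omega>. \<bar>0::real\<bar> ^ p)"
      by (intro integrable_cong_AE) auto
    then show ?thesis by simp
  next
    case 2
    have "integrable lborel (\<lambda>x. normal_density 0 \<sigma> x * \<bar>x - 0\<bar> ^ p)"
      using 2(1) by (rule integrable_normal_moment_abs)
    then show ?thesis
      using distributed_integrable[OF 2(2), of "\<lambda>x. \<bar>x\<bar> ^ p"] by simp
  qed
qed

text \<open>Expressing the characteristic function through the second moment covers the Dirac measure and the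
  nondegenerate laws by one formula.\<close>

lemma centered_gaussian_char:
  assumes "centered_gaussian M X"
  shows "(CLINT \<omega>|M. iexp (X \<omega>)) = of_real (exp (- expectation (\<lambda>\<omega>. (X \<omega>)\<^sup>2) / 2))"
proof -
  have [measurable]: "X \<in> borel_measurable M"
    using assms by (simp add: centered_gaussian_def)
  consider "AE \<omega> in M. X \<omega> = 0"
    | \<sigma> where "\<sigma> > 0" "distributed M lborel X (\<lambda>x. ennreal (normal_density 0 \<sigma> x))"
    using assms by (auto simp: centered_gaussian_def)
  then show ?thesis
  proof cases
    case 1
    have "(CLINT \<omega>|M. iexp (X \<omega>)) = (CLINT \<omega>|M. iexp 0)"
      using 1 by (intro integral_cong_AE) auto
    moreover have "expectation (\<lambda>\<omega>. (X \<omega>)\<^sup>2) = expectation (\<lambda>\<omega>. 0)"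
      using 1 by (intro integral_cong_AE) auto
    ultimately show ?thesis by (simp add: prob_space)
  next
    case 2
    have std: "distributed M lborel (\<lambda>\<omega>. (X \<omega> - 0) / \<sigma>) (\<lambda>x. ennreal (std_normal_density x))"
      using normal_standard_normal_convert[OF 2(1), of X 0] 2(2) by simp
    have "expectation (\<lambda>\<omega>. (X \<omega>)\<^sup>2) = \<sigma>\<^sup>2"
      using normal_distributed_variance[OF 2] normal_distributed_expectation[OF 2] by simp
    moreover have "(CLINT \<omega>|M. iexp (X \<omega>)) = char (distr M lborel (\<lambda>\<omega>. (X \<omega> - 0) / \<sigma>)) \<sigma>"
      using 2(1) by (simp add: char_def integral_distr)
    moreover have "distr M lborel (\<lambda>\<omega>. (X \<omega> - 0) / \<sigma>) = std_normal_distribution"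
      using std by (rule distributed_distr_eq_density)
    ultimately show ?thesis
      by (simp add: char_std_normal_distribution)
  qed
qed

end

context isonormal_gaussian_process begin

text \<open>A family \<open>h\<close> may repeat vectors, whereas the combinations in \<^const>\<open>centered_gaussian_family\<close>
  are indexed by the vectors themselves.  Coefficients of equal vectors are added.\<close>

lemma centered_gaussian_combination:
  fixes h :: "'i \<Rightarrow> 'h"
  assumes K: "finite K"
  shows "centered_gaussian M (\<lambda>\<omega>. \<Sum>k\<in>K. t k * W (h k) \<omega>)"
proof -
  have "(\<Sum>k\<in>K. t k * W (h k) \<omega>) = (\<Sum>g\<in>h ` K. (\<Sum>k | k \<in> K \<and> h k = g. t k) * W g \<omega>)" for \<omega>
    by (subst sum.image_gen[OF K, of _ h]) (auto simp: sum_distrib_right intro!: sum.cong)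
  then show ?thesis
    using gaussian K unfolding centered_gaussian_family_def by simp
qed

lemma centered_gaussian_W: "centered_gaussian M (W h)"
  using centered_gaussian_combination[of "{()}" "\<lambda>_. 1" "\<lambda>_. h"] by simp

lemma W_measurable [measurable]: "W h \<in> borel_measurable M"
  using centered_gaussian_W unfolding centered_gaussian_def by blast

lemma integrable_W_mult: "integrable M (\<lambda>\<omega>. W h \<omega> * W g \<omega>)"
proof (rule Bochner_Integration.integrable_bound)
  show "integrable M (\<lambda>\<omega>. \<bar>W h \<omega>\<bar>\<^sup>2 + \<bar>W g \<omega>\<bar>\<^sup>2)"
    by (intro Bochner_Integration.integrable_add centered_gaussian_integrable_power centered_gaussian_W)
  have "\<bar>a * b\<bar> \<le> \<bar>a\<bar>\<^sup>2 + \<bar>b\<bar>\<^sup>2" for a b :: real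
    using sum_squares_bound[of "\<bar>a\<bar>" "\<bar>b\<bar>"] mult_nonneg_nonneg[of "\<bar>a\<bar>" "\<bar>b\<bar>"]
    unfolding abs_mult by linarith
  then show "AE \<omega> in M. norm (W h \<omega> * W g \<omega>) \<le> norm (\<bar>W h \<omega>\<bar>\<^sup>2 + \<bar>W g \<omega>\<bar>\<^sup>2)"
    by (intro AE_I2) simp
qed simp

lemma char_W_combination:
  fixes h :: "'i \<Rightarrow> 'h"
  assumes K: "finite K"
  shows "(CLINT \<omega>|M. iexp (\<Sum>k\<in>K. t k * W (h k) \<omega>)) =
    of_real (exp (- (norm (\<Sum>k\<in>K. t k *\<^sub>R h k))\<^sup>2 / 2))"
proof -
  have "expectation (\<lambda>\<omega>. (\<Sum>k\<in>K. t k * W (h k) \<omega>)\<^sup>2) =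
      expectation (\<lambda>\<omega>. \<Sum>k\<in>K. \<Sum>l\<in>K. t k * t l * (W (h k) \<omega> * W (h l) \<omega>))"
    by (intro Bochner_Integration.integral_cong)
       (auto simp: power2_eq_square sum_product mult_ac)
  also have "\<dots> = (\<Sum>k\<in>K. \<Sum>l\<in>K. t k * t l * inner (h k) (h l))"
    by (simp add: integrable_W_mult covariance)
  also have "\<dots> = (norm (\<Sum>k\<in>K. t k *\<^sub>R h k))\<^sup>2"
    by (simp add: power2_norm_eq_inner inner_sum_left inner_sum_right inner_commute mult_ac
        sum_distrib_left)
  finally show ?thesis
    using centered_gaussian_char[OF centered_gaussian_combination[OF K, of t h]]
    by (simp only:)
qed

end

section \<open>Polynomial bounds\<close>

text \<open>The size function \<open>s\<close> is a parameter so that the same rules serve functions of one sequence, of a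
  pair of sequences, and of a pair together with an angle.  In the last case a size that ignores the
  angle yields bounds that are uniform along a path of rotations.\<close>

definition poly_bounded :: "('a \<Rightarrow> real) \<Rightarrow> ('a \<Rightarrow> 'b::real_normed_vector) \<Rightarrow> bool" where
  "poly_bounded s f \<longleftrightarrow> (\<exists>C p. 0 \<le> C \<and> (\<forall>x. norm (f x) \<le> C * s x ^ p))"

lemma poly_boundedI:
  assumes "0 \<le> C" "\<And>x. norm (f x) \<le> C * s x ^ p"
  shows "poly_bounded s f"
  using assms unfolding poly_bounded_def by blast

lemma poly_boundedE:
  assumes "poly_bounded s f"
  obtains C p where "0 \<le> C" "\<And>x. norm (f x) \<le> C * s x ^ p"
  using assms unfolding poly_bounded_def by (elim exE conjE) (rule that, auto)

lemma poly_bounded_mono: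
  assumes "poly_bounded s g" "\<And>x. norm (f x) \<le> norm (g x)"
  shows "poly_bounded s f"
  using assms order_trans unfolding poly_bounded_def by meson

lemma poly_bounded_norm: "poly_bounded s (\<lambda>x. norm (f x)) \<longleftrightarrow> poly_bounded s f"
  by (simp add: poly_bounded_def)

lemma poly_bounded_const: "poly_bounded s (\<lambda>_. c)"
  by (rule poly_boundedI[of "norm c" _ _ 0]) auto

lemma poly_bounded_self: "(\<And>x. 0 \<le> s x) \<Longrightarrow> poly_bounded s s"
  by (rule poly_boundedI[of 1 _ _ 1]) auto

lemma poly_bounded_add:
  assumes s: "\<And>x. 1 \<le> s x" and f: "poly_bounded s f" and g: "poly_bounded s g"
  shows "poly_bounded s (\<lambda>x. f x + g x)"
proof -
  obtain C p where C: "0 \<le> C" "\<And>x. norm (f x) \<le> C * s x ^ p" using f by (elim poly_boundedE) (rule that, auto)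
  obtain D q where D: "0 \<le> D" "\<And>x. norm (g x) \<le> D * s x ^ q" using g by (elim poly_boundedE) (rule that, auto)
  show ?thesis
  proof (rule poly_boundedI)
    show "0 \<le> C + D" using C D by simp
    fix x
    have "norm (f x + g x) \<le> C * s x ^ p + D * s x ^ q"
      using C(2)[of x] D(2)[of x] norm_triangle_ineq[of "f x" "g x"] by linarith
    also have "\<dots> \<le> C * s x ^ (p + q) + D * s x ^ (p + q)"
      using s[of x] C D by (intro add_mono mult_left_mono power_increasing) auto
    finally show "norm (f x + g x) \<le> (C + D) * s x ^ (p + q)" by (simp add: algebra_simps)
  qed
qed

lemma poly_bounded_mult:
  fixes f g :: "'a \<Rightarrow> real"
  assumes f: "poly_bounded s f" and g: "poly_bounded s g"
  shows "poly_bounded s (\<lambda>x. f x * g x)"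
proof -
  obtain C p where C: "0 \<le> C" "\<And>x. norm (f x) \<le> C * s x ^ p" using f by (elim poly_boundedE) (rule that, auto)
  obtain D q where D: "0 \<le> D" "\<And>x. norm (g x) \<le> D * s x ^ q" using g by (elim poly_boundedE) (rule that, auto)
  show ?thesis
  proof (rule poly_boundedI)
    show "0 \<le> C * D" using C D by simp
    fix x
    have "norm (f x * g x) \<le> (C * s x ^ p) * (D * s x ^ q)"
      unfolding norm_mult using C(2)[of x] D(2)[of x]
      by (intro mult_mono) (auto intro: order_trans[OF norm_ge_zero])
    then show "norm (f x * g x) \<le> (C * D) * s x ^ (p + q)" by (simp add: power_add mult_ac)
  qed
qed

lemma poly_bounded_scaleR:
  fixes f :: "'a \<Rightarrow> real" and g :: "'a \<Rightarrow> 'b::real_normed_vector"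
  assumes "poly_bounded s f" and "poly_bounded s g"
  shows "poly_bounded s (\<lambda>x. f x *\<^sub>R g x)"
  by (rule poly_bounded_mono[OF poly_bounded_mult[of s f "\<lambda>x. norm (g x)"]])
     (use assms in \<open>auto simp: poly_bounded_norm\<close>)

lemma poly_bounded_inner:
  fixes f g :: "'a \<Rightarrow> 'b::real_inner"
  assumes "poly_bounded s f" and "poly_bounded s g"
  shows "poly_bounded s (\<lambda>x. inner (f x) (g x))"
  by (rule poly_bounded_mono[OF poly_bounded_mult[of s "\<lambda>x. norm (f x)" "\<lambda>x. norm (g x)"]])
     (use assms in \<open>auto simp: poly_bounded_norm Cauchy_Schwarz_ineq2\<close>)

lemma poly_bounded_diff:
  assumes s: "\<And>x. 1 \<le> s x" and f: "poly_bounded s f" and g: "poly_bounded s g"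
  shows "poly_bounded s (\<lambda>x. f x - g x)"
proof -
  have "poly_bounded s (\<lambda>x. - g x)"
    by (rule poly_bounded_mono[OF g]) simp
  from poly_bounded_add[OF s f this] show ?thesis by simp
qed

lemma poly_bounded_sum:
  assumes s: "\<And>x. 1 \<le> s x" and f: "\<And>k. k \<in> K \<Longrightarrow> poly_bounded s (f k)"
  shows "poly_bounded s (\<lambda>x. \<Sum>k\<in>K. f k x)"
  using f by (induction K rule: infinite_finite_induct)
    (auto intro: poly_bounded_add[OF s] poly_bounded_const)

lemma poly_bounded_powr:
  assumes s: "\<And>x. 1 \<le> s x" and f: "poly_bounded s f" and r: "0 \<le> r"
  shows "poly_bounded s (\<lambda>x. norm (f x) powr r)"
proof -
  obtain C p where C: "0 \<le> C" "\<And>x. norm (f x) \<le> C * s x ^ p" using f by (elim poly_boundedE) (rule that, auto)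
  define n where "n = nat \<lceil>p * r\<rceil>"
  show ?thesis
  proof (rule poly_boundedI)
    show "0 \<le> C powr r" by simp
    fix x
    have "norm (f x) powr r \<le> (C * s x ^ p) powr r"
      using C r by (intro powr_mono2) auto
    also have "\<dots> = C powr r * s x powr (p * r)"
      using s[of x] C by (simp add: powr_mult powr_powr flip: powr_realpow)
    also have "\<dots> \<le> C powr r * s x powr n"
      using s[of x] r unfolding n_def
      by (intro mult_left_mono powr_mono) (linarith | simp)+
    also have "\<dots> = C powr r * s x ^ n"
      using s[of x] by (simp add: powr_realpow)
    finally show "norm (norm (f x) powr r) \<le> C powr r * s x ^ n" by simp
  qed
qed

lemma poly_bounded_power:
  fixes f :: "'a \<Rightarrow> real"
  assumes f: "poly_bounded s f"
  shows "poly_bounded s (\<lambda>x. f x ^ n)"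
  by (induction n) (auto intro: poly_bounded_mult[OF f] poly_bounded_const)

lemma poly_bounded_compose:
  assumes f: "poly_bounded s f" and g: "poly_bounded s' (\<lambda>x. s (g x))"
  shows "poly_bounded s' (\<lambda>x. f (g x))"
proof -
  obtain C p where C: "0 \<le> C" "\<And>x. norm (f x) \<le> C * s x ^ p" using f by (elim poly_boundedE) (rule that, auto)
  show ?thesis
  proof (rule poly_bounded_mono[OF poly_bounded_mult[OF poly_bounded_const poly_bounded_power[OF g]]])
    show "norm (f (g x)) \<le> norm (C * s (g x) ^ p)" for x
      using C(2)[of "g x"] by (auto intro: order_trans)
  qed
qed

lemma integrable_poly_bounded:
  fixes f :: "'a \<Rightarrow> 'b::{banach, second_countable_topology}"
  assumes "f \<in> borel_measurable N" "poly_bounded s f" "\<And>p. integrable N (\<lambda>x. s x ^ p)"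
  shows "integrable N f"
proof -
  obtain C p where C: "0 \<le> C" "\<And>x. norm (f x) \<le> C * s x ^ p" using assms(2) by (elim poly_boundedE) (rule that, auto)
  show ?thesis
  proof (rule Bochner_Integration.integrable_bound)
    show "integrable N (\<lambda>x. C * s x ^ p)" using assms(3) by simp
    show "AE x in N. norm (f x) \<le> norm (C * s x ^ p)"
      using C(2) by (intro AE_I2) (auto intro: order_trans[OF _ abs_ge_self])
  qed fact
qed

section \<open>Averages over an interval and over a probability space\<close>

text \<open>Integrals over an interval are written as averages with respect to a probability measure, so that
  Jensen's inequality and Fubini's theorem apply to them directly.\<close>

abbreviation uniform :: "real \<Rightarrow> real \<Rightarrow> real measure" where
  "uniform a b \<equiv> uniform_measure lborel {a..b}"

lemma prob_space_uniform: "a < b \<Longrightarrow> prob_space (uniform a b)"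
  by (intro prob_space_uniform_measure) auto

text \<open>The gauge integral gives the fundamental theorem for a derivative that need not be continuous; as
  the derivative is bounded and measurable, its gauge and Lebesgue integrals coincide.\<close>

lemma FTC_uniform:
  fixes c c' :: "real \<Rightarrow> real"
  assumes ab: "a < b" and deriv: "\<And>t. (c has_real_derivative c' t) (at t)"
    and meas [measurable]: "c' \<in> borel_measurable borel" and bound: "\<And>t. \<bar>c' t\<bar> \<le> B"
  shows "c b - c a = (b - a) * (\<integral>t. c' t \<partial>uniform a b)"
proof -
  have "(c' has_integral (c b - c a)) {a..b}"
    using ab deriv by (intro fundamental_theorem_of_calculus)
      (auto simp: has_real_derivative_iff_has_vector_derivative intro: has_vector_derivative_at_within)
  moreover have "set_integrable lborel {a..b} c'"
    unfolding set_integrable_def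
  proof (rule Bochner_Integration.integrable_bound)
    show "integrable lborel (\<lambda>t. B * indicator {a..b} t :: real)"
      using ab by (intro integrable_mult_right integrable_real_indicator) auto
    show "AE t in lborel. norm (indicator {a..b} t *\<^sub>R c' t) \<le> norm (B * indicator {a..b} t :: real)"
      using bound by (intro AE_I2) (auto simp: indicator_def intro: order_trans[OF _ abs_ge_self])
  qed simp
  ultimately have "(\<integral>t. indicator {a..b} t * c' t \<partial>lborel) = c b - c a"
    using set_borel_integral_eq_integral(2)[of "{a..b}" c'] by (simp add: integral_unique set_lebesgue_integral_def)
  moreover have "uniform a b = density lborel (\<lambda>t. ennreal (indicator {a..b} t / (b - a)))"
    unfolding uniform_measure_def using ab
    by (intro arg_cong[where f = "density lborel"] ext) (auto simp: divide_ennreal[of 1, simplified] indicator_def)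
  ultimately show ?thesis
    using ab by (simp add: integral_density)
qed

lemma integrable_prob_pair_dominated:
  fixes f :: "'a \<Rightarrow> 'b \<Rightarrow> real"
  assumes "prob_space U" "prob_space P"
    and [measurable]: "(\<lambda>(t, \<omega>). f t \<omega>) \<in> borel_measurable (U \<Otimes>\<^sub>M P)"
    and bound: "\<And>t \<omega>. \<omega> \<in> space P \<Longrightarrow> \<bar>f t \<omega>\<bar> \<le> B \<omega>" and B: "integrable P B"
  shows "integrable (U \<Otimes>\<^sub>M P) (\<lambda>(t, \<omega>). f t \<omega>)"
proof -
  interpret P: prob_space P by fact
  interpret U: prob_space U by fact
  interpret UP: pair_prob_space U P ..
  have B_int: "integrable (U \<Otimes>\<^sub>M P) (\<lambda>p. B (snd p))"
    using B by (intro UP.Fubini_integrable) auto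
  show ?thesis
  proof (rule Bochner_Integration.integrable_bound[OF B_int])
    show "AE p in U \<Otimes>\<^sub>M P. norm (case p of (t, \<omega>) \<Rightarrow> f t \<omega>) \<le> norm (B (snd p))"
      using bound by (intro AE_I2) (auto simp: space_pair_measure intro: order_trans[OF _ abs_ge_self])
  qed measurable
qed

lemma expectation_FTC_uniform:
  fixes c c' :: "real \<Rightarrow> 'a \<Rightarrow> real"
  assumes "prob_space P" and ab: "a < b"
    and deriv: "\<And>t \<omega>. \<omega> \<in> space P \<Longrightarrow> ((\<lambda>t. c t \<omega>) has_real_derivative c' t \<omega>) (at t)"
    and meas [measurable]: "(\<lambda>(t, \<omega>). c' t \<omega>) \<in> borel_measurable (borel \<Otimes>\<^sub>M P)"
    and bound: "\<And>t \<omega>. \<omega> \<in> space P \<Longrightarrow> \<bar>c' t \<omega>\<bar> \<le> B \<omega>" and B: "integrable P B"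
  shows "(\<integral>\<omega>. c b \<omega> - c a \<omega> \<partial>P) = (b - a) * (\<integral>t. (\<integral>\<omega>. c' t \<omega> \<partial>P) \<partial>uniform a b)"
    and "integrable (uniform a b) (\<lambda>t. \<integral>\<omega>. c' t \<omega> \<partial>P)"
proof -
  interpret P: prob_space P by fact
  interpret U: prob_space "uniform a b" using ab by (rule prob_space_uniform)
  interpret UP: pair_prob_space "uniform a b" P ..
  have S [measurable_cong]: "sets (uniform a b) = sets borel" by simp
  have int: "integrable (uniform a b \<Otimes>\<^sub>M P) (\<lambda>(t, \<omega>). c' t \<omega>)"
    by (rule integrable_prob_pair_dominated[OF U.prob_space_axioms P.prob_space_axioms _ bound B]) measurable
  have "(\<integral>\<omega>. c b \<omega> - c a \<omega> \<partial>P) = (\<integral>\<omega>. (b - a) * (\<integral>t. c' t \<omega> \<partial>uniform a b) \<partial>P)"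
  proof (rule Bochner_Integration.integral_cong)
    fix \<omega> assume \<omega>: "\<omega> \<in> space P"
    have "(\<lambda>t. c' t \<omega>) \<in> borel_measurable borel"
      using \<omega> by measurable
    with \<omega> show "c b \<omega> - c a \<omega> = (b - a) * (\<integral>t. c' t \<omega> \<partial>uniform a b)"
      by (intro FTC_uniform[OF ab deriv _ bound])
  qed simp
  then show "(\<integral>\<omega>. c b \<omega> - c a \<omega> \<partial>P) = (b - a) * (\<integral>t. (\<integral>\<omega>. c' t \<omega> \<partial>P) \<partial>uniform a b)"
    by (simp add: UP.Fubini_integral[OF int])
  show "integrable (uniform a b) (\<lambda>t. \<integral>\<omega>. c' t \<omega> \<partial>P)"
    using int by (rule UP.integrable_fst)
qed

text \<open>Jensen's inequality for the power \<open>r\<close> of a nonnegative function.  Integrating the tangent to the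
  power at the mean of \<open>f\<close>, which is an instance of Young's inequality, covers functions that vanish
  somewhere.\<close>

lemma (in prob_space) power_mean_ineq:
  fixes f :: "'a \<Rightarrow> real"
  assumes r: "1 \<le> r" and f: "integrable M f" "\<And>\<omega>. 0 \<le> f \<omega>" and fr: "integrable M (\<lambda>\<omega>. f \<omega> powr r)"
  shows "expectation f powr r \<le> expectation (\<lambda>\<omega>. f \<omega> powr r)"
proof (cases "r = 1")
  case True
  then show ?thesis using f by (simp add: integral_nonneg_AE)
next
  case False
  then have r: "1 < r" using r by simp
  define m where "m = expectation f"
  have m: "0 \<le> m" unfolding m_def using f by (intro integral_nonneg_AE) auto
  define r' where "r' = r / (r - 1)"
  have r': "1 < r'" "1 / r + 1 / r' = 1" using r by (auto simp: r'_def field_simps)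
  have mr: "(m powr (r - 1)) powr r' = m powr r"
    using r by (simp add: powr_powr r'_def)
  have mm: "m * m powr (r - 1) = m powr r"
    using m by (cases "m = 0") (auto simp: powr_diff)
  \<comment> \<open>Young's inequality, with equality at \<open>f \<omega> = m\<close>.\<close>
  have young: "f \<omega> * m powr (r - 1) \<le> f \<omega> powr r / r + m powr r / r'" for \<omega>
    using Youngs_inequality[OF r r'(1,2) f(2), of "m powr (r - 1)"] mr by simp
  have "m powr r = expectation (\<lambda>\<omega>. f \<omega> * m powr (r - 1))"
    using mm by (simp add: m_def)
  also have "\<dots> \<le> expectation (\<lambda>\<omega>. f \<omega> powr r / r + m powr r / r')"
    using f fr by (intro integral_mono young) auto
  also have "\<dots> = expectation (\<lambda>\<omega>. f \<omega> powr r) / r + m powr r / r'"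
    using fr by (simp add: prob_space)
  finally have "m powr r * (1 - 1 / r') \<le> expectation (\<lambda>\<omega>. f \<omega> powr r) / r"
    by (simp add: algebra_simps)
  moreover have "1 - 1 / r' = 1 / r" using r'(2) by simp
  ultimately show ?thesis
    using r by (simp add: m_def divide_le_cancel)
qed

section \<open>Functions with a gradient of polynomial growth\<close>

text \<open>The added \<open>1\<close> makes powers of the size increasing in the exponent, and it makes the size of a
  rotated sequence at most the product of the sizes of the two sequences.\<close>

definition coord_size :: "'i set \<Rightarrow> ('i \<Rightarrow> real) \<Rightarrow> real" where
  "coord_size K x = 1 + (\<Sum>k\<in>K. \<bar>x k\<bar>)"

lemma coord_size_ge_1: "1 \<le> coord_size K x"
  by (simp add: coord_size_def sum_nonneg)

lemma abs_coord_size [simp]: "\<bar>coord_size K x\<bar> = coord_size K x"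
  using coord_size_ge_1[of K x] by simp

lemma coord_size_measurable [measurable]: "coord_size K \<in> borel_measurable borel"
  unfolding coord_size_def by measurable

lemma coord_size_rotated: "coord_size K (rotated \<theta> x y) \<le> coord_size K x * coord_size K y"
proof -
  have "\<bar>rotated \<theta> x y k\<bar> \<le> \<bar>x k\<bar> + \<bar>y k\<bar>" for k
  proof -
    have "\<bar>cos \<theta> * x k\<bar> \<le> 1 * \<bar>x k\<bar>" "\<bar>sin \<theta> * y k\<bar> \<le> 1 * \<bar>y k\<bar>"
      unfolding abs_mult by (intro mult_right_mono; simp)+
    then show ?thesis unfolding rotated_def by linarith
  qed
  then have "coord_size K (rotated \<theta> x y) \<le> 1 + ((\<Sum>k\<in>K. \<bar>x k\<bar>) + (\<Sum>k\<in>K. \<bar>y k\<bar>))"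
    unfolding coord_size_def sum.distrib[symmetric] by (intro add_left_mono sum_mono)
  also have "\<dots> \<le> coord_size K x * coord_size K y"
    using mult_nonneg_nonneg[of "\<Sum>k\<in>K. \<bar>x k\<bar>" "\<Sum>k\<in>K. \<bar>y k\<bar>"]
    by (simp add: coord_size_def algebra_simps sum_nonneg)
  finally show ?thesis .
qed

text \<open>The derivative at \<open>x\<close> in the direction \<open>u\<close> of a function with partial derivatives \<open>a k\<close>, \<open>k \<in> K\<close>.\<close>

definition directional :: "'i set \<Rightarrow> ('i \<Rightarrow> 'e \<Rightarrow> 'v) \<Rightarrow> 'e \<Rightarrow> ('i \<Rightarrow> real) \<Rightarrow> 'v::real_vector" where
  "directional K a x u = (\<Sum>k\<in>K. u k *\<^sub>R a k x)"

text \<open>Differentiability is required only along curves, since the type of all sequences carries no norm.\<close>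

definition tempered_gradient ::
  "'i set \<Rightarrow> (('i::countable \<Rightarrow> real) \<Rightarrow> 'v::{real_inner, banach, second_countable_topology})
    \<Rightarrow> ('i \<Rightarrow> ('i \<Rightarrow> real) \<Rightarrow> 'v) \<Rightarrow> bool" where
  "tempered_gradient K \<Phi> a \<longleftrightarrow> finite K \<and>
    \<Phi> \<in> borel_measurable borel \<and> poly_bounded (coord_size K) \<Phi> \<and>
    (\<forall>k\<in>K. a k \<in> borel_measurable borel \<and> poly_bounded (coord_size K) (a k)) \<and>
    (\<forall>c c' t. (\<forall>k. ((\<lambda>s. c s k) has_real_derivative c' k) (at t)) \<longrightarrow>
      ((\<lambda>s. \<Phi> (c s)) has_vector_derivative directional K a (c t) c') (at t))"

lemma directional_measurable [measurable]:
  fixes a :: "'i::countable \<Rightarrow> ('i \<Rightarrow> real) \<Rightarrow> 'v::{real_inner, banach, second_countable_topology}"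
  assumes a: "\<And>k. k \<in> K \<Longrightarrow> a k \<in> borel_measurable borel"
    and [measurable]: "f \<in> borel_measurable M" "u \<in> borel_measurable M"
  shows "(\<lambda>z. directional K a (f z) (u z)) \<in> borel_measurable M"
proof -
  have [measurable]: "(\<lambda>z. u z i) \<in> borel_measurable M" for i
    by (rule measurable_product_then_coordinatewise) fact
  have [measurable]: "(\<lambda>z. a k (f z)) \<in> borel_measurable M" if "k \<in> K" for k
    using a[OF that] by measurable
  show ?thesis unfolding directional_def by (intro borel_measurable_sum) measurable
qed

lemma directional_poly_bounded:
  assumes s: "\<And>z. 1 \<le> s z" and K: "finite K"
    and a: "\<And>k. k \<in> K \<Longrightarrow> poly_bounded (coord_size K) (a k)"
    and f: "poly_bounded s (\<lambda>z. coord_size K (f z))" and u: "poly_bounded s (\<lambda>z. coord_size K (u z))"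
  shows "poly_bounded s (\<lambda>z. directional K a (f z) (u z))"
  unfolding directional_def
proof (intro poly_bounded_sum[OF s] poly_bounded_scaleR)
  fix k assume k: "k \<in> K"
  show "poly_bounded s (\<lambda>z. a k (f z))" by (rule poly_bounded_compose[of "coord_size K" "a k" s f, OF a[OF k] f])
  have "\<bar>u z k\<bar> \<le> coord_size K (u z)" for z
    using member_le_sum[OF k, of "\<lambda>k. \<bar>u z k\<bar>"] K by (simp add: coord_size_def)
  then show "poly_bounded s (\<lambda>z. u z k)"
    by (intro poly_bounded_mono[OF u]) (auto intro: order_trans[OF _ abs_ge_self])
qed

lemma directional_linear:
  "directional K a x (\<lambda>k. c * u k) = c *\<^sub>R directional K a x u"
  "directional K a x (\<lambda>k. - u k) = - directional K a x u"
  by (simp_all add: directional_def scaleR_sum_right sum_negf)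

lemma has_real_derivative_inner:
  fixes f g :: "real \<Rightarrow> 'b::real_inner"
  assumes "(f has_vector_derivative f') (at t)" "(g has_vector_derivative g') (at t)"
  shows "((\<lambda>s. inner (f s) (g s)) has_real_derivative (inner (f t) g' + inner f' (g t))) (at t)"
proof -
  have "((\<lambda>s. inner (f s) (g s)) has_derivative
      (\<lambda>h. inner (f t) (h *\<^sub>R g') + inner (h *\<^sub>R f') (g t))) (at t)"
    using assms unfolding has_vector_derivative_def by (rule has_derivative_inner)
  then show ?thesis
    unfolding has_field_derivative_def
    by (rule has_derivative_eq_rhs) (auto simp: algebra_simps)
qed

lemma tempered_gradientD:
  assumes "tempered_gradient K \<Phi> a"
  shows "finite K" "\<Phi> \<in> borel_measurable borel" "poly_bounded (coord_size K) \<Phi>"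
    "\<And>k. k \<in> K \<Longrightarrow> a k \<in> borel_measurable borel" "\<And>k. k \<in> K \<Longrightarrow> poly_bounded (coord_size K) (a k)"
    "\<And>c c' t. (\<And>k. ((\<lambda>s. c s k) has_real_derivative c' k) (at t)) \<Longrightarrow>
      ((\<lambda>s. \<Phi> (c s)) has_vector_derivative directional K a (c t) c') (at t)"
  using assms unfolding tempered_gradient_def by auto

section \<open>Rotation invariant laws\<close>

definition pair_size :: "'i set \<Rightarrow> ('i \<Rightarrow> real) \<times> ('i \<Rightarrow> real) \<Rightarrow> real" where
  "pair_size K = (\<lambda>(x, y). coord_size K x * coord_size K y)"

lemma pair_size_ge_1: "1 \<le> pair_size K p"
  using mult_mono[OF coord_size_ge_1 coord_size_ge_1, of K _ K]
  by (auto simp: pair_size_def split: prod.split) (smt (verit) coord_size_ge_1)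

lemma pair_size_poly_bounded:
  "poly_bounded (\<lambda>z. pair_size K (P z)) (\<lambda>z. coord_size K (fst (P z)))"
  "poly_bounded (\<lambda>z. pair_size K (P z)) (\<lambda>z. coord_size K (snd (P z)))"
  "poly_bounded (\<lambda>z. pair_size K (P z)) (\<lambda>z. coord_size K (rotated (\<theta> z) (fst (P z)) (snd (P z))))"
proof -
  have *: "coord_size K x \<le> coord_size K x * coord_size K y" "coord_size K x \<le> coord_size K y * coord_size K x" for x y
    using mult_left_mono[OF coord_size_ge_1[of K y], of "coord_size K x"] coord_size_ge_1[of K x]
    by (simp_all add: mult.commute)
  have abs: "\<bar>coord_size K x\<bar> = coord_size K x" for x using coord_size_ge_1[of K x] by simp
  show "poly_bounded (\<lambda>z. pair_size K (P z)) (\<lambda>z. coord_size K (fst (P z)))"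
    by (rule poly_boundedI[of 1 _ _ 1]) (auto simp: pair_size_def abs * split_beta)
  show "poly_bounded (\<lambda>z. pair_size K (P z)) (\<lambda>z. coord_size K (snd (P z)))"
    by (rule poly_boundedI[of 1 _ _ 1]) (auto simp: pair_size_def abs * split_beta)
  show "poly_bounded (\<lambda>z. pair_size K (P z)) (\<lambda>z. coord_size K (rotated (\<theta> z) (fst (P z)) (snd (P z))))"
    by (rule poly_boundedI[of 1 _ _ 1]) (auto simp: pair_size_def abs coord_size_rotated split_beta)
qed

text \<open>When one of the two rotated sequences is frozen, its size is absorbed in the constant.\<close>

lemma poly_bounded_rotated_fixed:
  assumes "poly_bounded s (\<lambda>z. coord_size K (w z))"
  shows "poly_bounded s (\<lambda>z. coord_size K (rotated \<theta> x (w z)))"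
  by (rule poly_bounded_mono[OF poly_bounded_mult[OF poly_bounded_const[of s "coord_size K x"] assms]])
     (simp add: abs_mult coord_size_rotated)

lemma rotated_deriv: "((\<lambda>t. rotated t x y k) has_real_derivative rotated (\<theta> + pi / 2) x y k) (at \<theta>)"
  unfolding rotated_def
  by (auto intro!: derivative_eq_intros simp: cos_add sin_add)

text \<open>This undoes the rotation when an expectation is rewritten in terms of the rotated pair.\<close>

lemma rotated_rotated_back: "rotated (- \<theta>) (rotated \<theta> x y) (rotated (\<theta> + pi / 2) x y) = x"
proof
  fix k
  have "cos (\<theta> + pi / 2) = - sin \<theta>" "sin (\<theta> + pi / 2) = cos \<theta>"
    by (simp_all add: cos_add sin_add)
  then have "rotated (- \<theta>) (rotated \<theta> x y) (rotated (\<theta> + pi / 2) x y) k = ((cos \<theta>)\<^sup>2 + (sin \<theta>)\<^sup>2) * x k"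
    unfolding rotated_def cos_minus sin_minus by algebra
  then show "rotated (- \<theta>) (rotated \<theta> x y) (rotated (\<theta> + pi / 2) x y) k = x k" by simp
qed

lemma rotated_special: "rotated 0 x y = x" "rotated (pi / 2) x y = y" "rotated (2 * pi) x y = x"
    "rotated (2 * pi + pi / 2) x y = y"
  using cos_add[of "2 * pi" "pi / 2"] sin_add[of "2 * pi" "pi / 2"]
  by (simp_all add: rotated_def)

text \<open>What the inequalities on the sequence space use of a Gaussian law.\<close>

locale rotation_invariant = prob_space \<mu> for \<mu> :: "('i::countable \<Rightarrow> real) measure" +
  assumes sets_eq [measurable_cong]: "sets \<mu> = sets borel"
    and integrable_coordinate_power: "integrable \<mu> (\<lambda>x. \<bar>x i\<bar> ^ p)"
    and rotation: "distr (\<mu> \<Otimes>\<^sub>M \<mu>) (borel \<Otimes>\<^sub>M borel)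
      (\<lambda>(x, y). (rotated \<theta> x y, rotated (\<theta> + pi / 2) x y)) = \<mu> \<Otimes>\<^sub>M \<mu>"
begin

sublocale PP: pair_prob_space \<mu> \<mu> ..

abbreviation pair :: "(('i \<Rightarrow> real) \<times> ('i \<Rightarrow> real)) measure" where
  "pair \<equiv> \<mu> \<Otimes>\<^sub>M \<mu>"

lemma space_eq [simp]: "space \<mu> = UNIV"
  using sets_eq_imp_space_eq[OF sets_eq] by simp

text \<open>The size is at most \<open>card K + 1\<close> times its largest summand, and a power of that summand is at most
  the sum of the powers of all summands.\<close>

lemma integrable_coord_size_power:
  assumes K: "finite K"
  shows "integrable \<mu> (\<lambda>x. coord_size K x ^ p)"
proof (rule Bochner_Integration.integrable_bound)
  let ?g = "\<lambda>x. real (card K + 1) ^ p * (1 + (\<Sum>k\<in>K. \<bar>x k\<bar> ^ p))"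
  show "integrable \<mu> ?g"
    using integrable_coordinate_power by simp
  have "coord_size K x ^ p \<le> ?g x" for x :: "'i \<Rightarrow> real"
  proof -
    define m where "m = Max (insert 1 ((\<lambda>k. \<bar>x k\<bar>) ` K))"
    have le: "1 \<le> m" "\<And>k. k \<in> K \<Longrightarrow> \<bar>x k\<bar> \<le> m"
      using K by (auto simp: m_def intro!: Max_ge)
    have "coord_size K x \<le> 1 * m + card K * m"
      unfolding coord_size_def using le sum_bounded_above[of K "\<lambda>k. \<bar>x k\<bar>" m] by auto
    then have "coord_size K x \<le> real (card K + 1) * m" by (simp add: algebra_simps)
    then have "coord_size K x ^ p \<le> (real (card K + 1) * m) ^ p"
      using coord_size_ge_1[of K x] by (intro power_mono) auto
    also have "\<dots> = real (card K + 1) ^ p * m ^ p" by (rule power_mult_distrib)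
    also have "m ^ p \<le> 1 + (\<Sum>k\<in>K. \<bar>x k\<bar> ^ p)"
    proof -
      have "m \<in> insert 1 ((\<lambda>k. \<bar>x k\<bar>) ` K)"
        unfolding m_def using K by (intro Max_in) auto
      then consider "m = 1" | k where "k \<in> K" "m = \<bar>x k\<bar>" by auto
      then show ?thesis
      proof cases
        case 1
        then show ?thesis by (simp add: sum_nonneg)
      next
        case 2
        then show ?thesis
          using member_le_sum[OF 2(1), of "\<lambda>k. \<bar>x k\<bar> ^ p"] K by simp
      qed
    qed
    finally show ?thesis by (simp add: mult_left_mono)
  qed
  then show "AE x in \<mu>. norm (coord_size K x ^ p) \<le> norm (?g x)"
    using coord_size_ge_1[of K] by (intro AE_I2) (auto intro!: order_trans[OF _ abs_ge_self] simp: abs_of_nonneg order_trans[OF zero_le_one])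
qed simp

lemma integrable_pair_size_power:
  assumes K: "finite K"
  shows "integrable pair (\<lambda>p. pair_size K p ^ n)"
proof -
  have "integrable pair (\<lambda>(x, y). coord_size K x ^ n * coord_size K y ^ n)"
  proof (rule PP.Fubini_integrable)
    show "integrable \<mu> (\<lambda>x. \<integral>y. norm (case (x, y) of (x, y) \<Rightarrow> coord_size K x ^ n * coord_size K y ^ n) \<partial>\<mu>)"
      using integrable_coord_size_power[OF K, of n] by (simp add: abs_mult)
    show "AE x in \<mu>. integrable \<mu> (\<lambda>y. case (x, y) of (x, y) \<Rightarrow> coord_size K x ^ n * coord_size K y ^ n)"
      using integrable_coord_size_power[OF K, of n] by simp
  qed measurable
  then show ?thesis
    by (simp add: pair_size_def split_beta' power_mult_distrib)
qed

lemma integrable_tempered: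
  fixes f :: "('i \<Rightarrow> real) \<Rightarrow> 'b::{banach, second_countable_topology}"
  assumes "finite K" "poly_bounded (coord_size K) f" "f \<in> borel_measurable borel"
  shows "integrable \<mu> f"
  using assms integrable_coord_size_power by (intro integrable_poly_bounded[of f \<mu> "coord_size K"]) auto

lemma integrable_tempered_pair:
  fixes f :: "('i \<Rightarrow> real) \<times> ('i \<Rightarrow> real) \<Rightarrow> 'b::{banach, second_countable_topology}"
  assumes "finite K" "poly_bounded (pair_size K) f" "f \<in> borel_measurable (borel \<Otimes>\<^sub>M borel)"
  shows "integrable pair f"
  using assms integrable_pair_size_power by (intro integrable_poly_bounded[of f pair "pair_size K"]) auto

lemma integral_rotated:
  fixes f :: "('i \<Rightarrow> real) \<times> ('i \<Rightarrow> real) \<Rightarrow> 'b::{banach, second_countable_topology}"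
  assumes f [measurable]: "f \<in> borel_measurable (borel \<Otimes>\<^sub>M borel)"
  shows "(\<integral>p. f (rotated \<theta> (fst p) (snd p), rotated (\<theta> + pi / 2) (fst p) (snd p)) \<partial>pair) = (\<integral>p. f p \<partial>pair)"
proof -
  have "(\<integral>p. f p \<partial>pair) = (\<integral>p. f p \<partial>distr pair (borel \<Otimes>\<^sub>M borel)
      (\<lambda>(x, y). (rotated \<theta> x y, rotated (\<theta> + pi / 2) x y)))"
    by (simp only: rotation)
  also have "\<dots> = (\<integral>p. f (rotated \<theta> (fst p) (snd p), rotated (\<theta> + pi / 2) (fst p) (snd p)) \<partial>pair)"
    by (subst integral_distr) (auto simp: split_beta)
  finally show ?thesis by simp
qed

lemma integral_rotated_fst:
  fixes f :: "('i \<Rightarrow> real) \<Rightarrow> 'b::{banach, second_countable_topology}"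
  assumes f [measurable]: "f \<in> borel_measurable borel" and int: "integrable \<mu> f"
  shows "(\<integral>p. f (rotated \<theta> (fst p) (snd p)) \<partial>pair) = (\<integral>x. f x \<partial>\<mu>)"
proof -
  have "(\<integral>p. f (rotated \<theta> (fst p) (snd p)) \<partial>pair) = (\<integral>p. f (fst p) \<partial>pair)"
    using integral_rotated[of "\<lambda>p. f (fst p)" \<theta>] by simp
  also have "\<dots> = (\<integral>x. \<integral>y. f x \<partial>\<mu> \<partial>\<mu>)"
    using int by (subst PP.integral_fst'[symmetric]) (auto intro!: PP.Fubini_integrable)
  finally show ?thesis using prob_space by simp
qed

text \<open>The polynomial bound does not depend on the parameter \<open>t\<close> of the path, which gives the integrable
  majorant.\<close>

lemma expectation_FTC_pair:
  fixes c c' :: "real \<Rightarrow> ('i \<Rightarrow> real) \<times> ('i \<Rightarrow> real) \<Rightarrow> real"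
  assumes K: "finite K" and ab: "\<alpha> < \<beta>"
    and deriv: "\<And>t p. ((\<lambda>t. c t p) has_real_derivative c' t p) (at t)"
    and meas: "(\<lambda>(t, p). c' t p) \<in> borel_measurable (borel \<Otimes>\<^sub>M (borel \<Otimes>\<^sub>M borel))"
    and bound: "poly_bounded (\<lambda>z. pair_size K (snd z)) (\<lambda>z. c' (fst z) (snd z))"
  shows "(\<integral>p. c \<beta> p - c \<alpha> p \<partial>pair) = (\<beta> - \<alpha>) * (\<integral>t. (\<integral>p. c' t p \<partial>pair) \<partial>uniform \<alpha> \<beta>)"
    and "integrable (uniform \<alpha> \<beta>) (\<lambda>t. \<integral>p. c' t p \<partial>pair)"
proof -
  obtain C n where C: "\<And>z. norm (c' (fst z) (snd z)) \<le> C * pair_size K (snd z) ^ n"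
    using bound by (elim poly_boundedE) (rule that, auto)
  have m: "(\<lambda>(t, p). c' t p) \<in> borel_measurable (borel \<Otimes>\<^sub>M pair)"
    using meas by measurable
  have b: "\<bar>c' t p\<bar> \<le> C * pair_size K p ^ n" for t p
    using C[of "(t, p)"] by simp
  have i: "integrable pair (\<lambda>p. C * pair_size K p ^ n)"
    using integrable_pair_size_power[OF K] by simp
  note * = PP.prob_space_axioms ab deriv m b i
  show "(\<integral>p. c \<beta> p - c \<alpha> p \<partial>pair) = (\<beta> - \<alpha>) * (\<integral>t. (\<integral>p. c' t p \<partial>pair) \<partial>uniform \<alpha> \<beta>)"
    "integrable (uniform \<alpha> \<beta>) (\<lambda>t. \<integral>p. c' t p \<partial>pair)"
    using expectation_FTC_uniform[OF *] by auto
qed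

lemma integral_pair_fst:
  fixes f :: "('i \<Rightarrow> real) \<Rightarrow> 'b::{banach, second_countable_topology}"
  assumes "f \<in> borel_measurable borel" "integrable \<mu> f"
  shows "(\<integral>p. f (fst p) \<partial>pair) = (\<integral>x. f x \<partial>\<mu>)"
  using integral_rotated_fst[OF assms, of 0] by (simp add: rotated_special)

section \<open>The covariance formula\<close>

text \<open>The path from \<open>x\<close> to \<open>y\<close> changes the expectation of \<open>\<Phi> x \<bullet> \<Gamma> x\<^sub>\<theta>\<close> from that of \<open>\<Phi> x \<bullet> \<Gamma> x\<close> to
  the product of the means.  In its derivative the rotation is undone, so that the direction of
  differentiation becomes the independent copy \<open>y\<close>.\<close>

lemma covariance_rotation:
  fixes \<Phi> \<Gamma> :: "('i \<Rightarrow> real) \<Rightarrow> 'v::{real_inner, banach, second_countable_topology}"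
  assumes \<Phi>: "tempered_gradient K \<Phi> a" and \<Gamma>: "tempered_gradient K \<Gamma> b"
  defines "A \<equiv> \<lambda>\<theta>. \<integral>p. inner (\<Phi> (rotated (- \<theta>) (fst p) (snd p))) (directional K b (fst p) (snd p)) \<partial>pair"
  shows "(\<integral>x. inner (\<Phi> x) (\<Gamma> x) \<partial>\<mu>) - inner (\<integral>x. \<Phi> x \<partial>\<mu>) (\<integral>x. \<Gamma> x \<partial>\<mu>) =
      (pi / 2) * (\<integral>\<theta>. - A \<theta> \<partial>uniform 0 (pi / 2))"
    and "integrable (uniform 0 (pi / 2)) A"
proof -
  note P = tempered_gradientD[OF \<Phi>] and G = tempered_gradientD[OF \<Gamma>]
  note [measurable] = P(2) G(2) directional_measurable[OF G(4)]
  define c where "c \<theta> p = inner (\<Phi> (fst p)) (\<Gamma> (rotated \<theta> (fst p) (snd p)))" for \<theta> p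
  define c' where "c' \<theta> p = inner (\<Phi> (fst p))
    (directional K b (rotated \<theta> (fst p) (snd p)) (rotated (\<theta> + pi / 2) (fst p) (snd p)))" for \<theta> p
  have deriv: "((\<lambda>t. c t p) has_real_derivative c' t p) (at t)" for t p
    unfolding c_def c'_def
    using has_real_derivative_inner[OF has_vector_derivative_const[of "\<Phi> (fst p)"]
        G(6)[of "\<lambda>t. rotated t (fst p) (snd p)", OF rotated_deriv]] by simp
  have meas: "(\<lambda>(t, p). c' t p) \<in> borel_measurable (borel \<Otimes>\<^sub>M (borel \<Otimes>\<^sub>M borel))"
    unfolding c'_def by measurable
  have bound: "poly_bounded (\<lambda>z. pair_size K (snd z)) (\<lambda>z. c' (fst z) (snd z))"
    unfolding c'_def
    by (intro poly_bounded_inner directional_poly_bounded P G pair_size_ge_1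
        pair_size_poly_bounded poly_bounded_compose[OF P(3)])
  have c'_A: "(\<integral>p. c' \<theta> p \<partial>pair) = A \<theta>" for \<theta>
    unfolding A_def c'_def
    by (subst integral_rotated[symmetric, of _ \<theta>]) (simp_all add: rotated_rotated_back)
  note FTC = expectation_FTC_pair[OF P(1) _ deriv meas bound, of 0 "pi / 2", unfolded c'_A]
  show "integrable (uniform 0 (pi / 2)) A"
    using FTC(2) by simp
  have int: "integrable \<mu> \<Phi>" "integrable \<mu> \<Gamma>" "integrable \<mu> (\<lambda>x. inner (\<Phi> x) (\<Gamma> x))"
    by (rule integrable_tempered[OF P(1)]; (intro P G poly_bounded_inner | measurable))+
  have int': "integrable pair (\<lambda>p. inner (\<Phi> (fst p)) (\<Gamma> (snd p)))"
    "integrable pair (\<lambda>p. inner (\<Phi> (fst p)) (\<Gamma> (fst p)))"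
    by (rule integrable_tempered_pair[OF P(1)];
        (intro poly_bounded_inner poly_bounded_compose[OF P(3)] poly_bounded_compose[OF G(3)]
           pair_size_poly_bounded(1,2)[of K "\<lambda>p. p"] | measurable))+
  have "(\<integral>p. c (pi / 2) p - c 0 p \<partial>pair) =
      (\<integral>p. inner (\<Phi> (fst p)) (\<Gamma> (snd p)) \<partial>pair) - (\<integral>p. inner (\<Phi> (fst p)) (\<Gamma> (fst p)) \<partial>pair)"
    unfolding c_def rotated_special using int' by (rule Bochner_Integration.integral_diff)
  also have "(\<integral>p. inner (\<Phi> (fst p)) (\<Gamma> (snd p)) \<partial>pair) = (\<integral>x. \<integral>y. inner (\<Phi> x) (\<Gamma> y) \<partial>\<mu> \<partial>\<mu>)"
    by (subst PP.integral_fst'[OF int'(1), symmetric]) simp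
  also have "\<dots> = inner (\<integral>x. \<Phi> x \<partial>\<mu>) (\<integral>x. \<Gamma> x \<partial>\<mu>)"
    using int by simp
  also have "(\<integral>p. inner (\<Phi> (fst p)) (\<Gamma> (fst p)) \<partial>pair) = (\<integral>x. inner (\<Phi> x) (\<Gamma> x) \<partial>\<mu>)"
    using int by (intro integral_pair_fst[of "\<lambda>x. inner (\<Phi> x) (\<Gamma> x)"]) auto
  finally show "(\<integral>x. inner (\<Phi> x) (\<Gamma> x) \<partial>\<mu>) - inner (\<integral>x. \<Phi> x \<partial>\<mu>) (\<integral>x. \<Gamma> x \<partial>\<mu>) =
      (pi / 2) * (\<integral>\<theta>. - A \<theta> \<partial>uniform 0 (pi / 2))"
    using FTC(1) by (simp add: field_simps)
qed

text \<open>Gaussian integration by parts in the variable \<open>y\<close>, with \<open>x\<close> fixed.  Let \<open>z\<close> be independent of \<open>y\<close>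
  and rotate this pair through a full turn.  The function
  \<open>\<beta> \<mapsto> \<Phi> (cos \<theta> x - sin \<theta> y\<^sub>\<beta>) \<bullet> L y\<^sub>\<beta>'\<close> is periodic, hence its derivative averages to \<open>0\<close>; the
  expectation of that derivative is the same at every angle, hence equals \<open>0\<close> at angle \<open>0\<close>, which is
  the claim.\<close>

lemma integration_by_parts:
  fixes \<Phi> :: "('i \<Rightarrow> real) \<Rightarrow> 'v::{real_inner, banach, second_countable_topology}"
    and b :: "'i \<Rightarrow> ('i \<Rightarrow> real) \<Rightarrow> 'v" and x :: "'i \<Rightarrow> real"
  assumes \<Phi>: "tempered_gradient K \<Phi> a"
  defines "L \<equiv> directional K b x"
  shows "(\<integral>y. inner (\<Phi> (rotated (- \<theta>) x y)) (L y) \<partial>\<mu>) =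
    - sin \<theta> * (\<integral>p. inner (directional K a (rotated (- \<theta>) x (fst p)) (snd p)) (L (snd p)) \<partial>pair)"
proof -
  note P = tempered_gradientD[OF \<Phi>]
  \<comment> \<open>With the base point frozen the coefficients are constant functions, so the rules for
    \<^const>\<open>directional\<close> apply to \<open>L\<close>.\<close>
  have L_eq: "L = directional K (\<lambda>k _. b k x) x" by (simp add: L_def directional_def fun_eq_iff)
  have L_meas: "(\<lambda>z. L (u z)) \<in> borel_measurable N" if "u \<in> borel_measurable N" for u and N :: "'z measure"
    unfolding L_eq using that by (intro directional_measurable) auto
  have L_pb: "poly_bounded s (\<lambda>z. L (u z))"
    if "\<And>z. 1 \<le> s z" "poly_bounded s (\<lambda>z. coord_size K (u z))" for s :: "'z \<Rightarrow> real" and u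
    unfolding L_eq using that
    by (intro directional_poly_bounded P(1) poly_bounded_const) (auto intro: poly_bounded_const)
  note [measurable] = P(2) directional_measurable[OF P(4)] L_meas
  define c where "c \<beta> p = inner (\<Phi> (rotated (- \<theta>) x (rotated \<beta> (fst p) (snd p))))
    (L (rotated (\<beta> + pi / 2) (fst p) (snd p)))" for \<beta> p
  \<comment> \<open>The derivative of \<open>c\<close> at angle \<open>\<beta>\<close> is \<open>f\<close> at the rotated pair.\<close>
  define f where "f p = inner (\<Phi> (rotated (- \<theta>) x (fst p))) (- L (fst p))
    + inner (- sin \<theta> *\<^sub>R directional K a (rotated (- \<theta>) x (fst p)) (snd p)) (L (snd p))" for p
  define rot where "rot \<beta> p = (rotated \<beta> (fst p) (snd p), rotated (\<beta> + pi / 2) (fst p) (snd p :: 'i \<Rightarrow> real))" for \<beta> p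
  have quarter: "rotated (\<beta> + pi / 2 + pi / 2) y z = (\<lambda>k. - rotated \<beta> y z k)" for \<beta> and y z :: "'i \<Rightarrow> real"
    by (simp add: rotated_def fun_eq_iff cos_add sin_add)
  have deriv: "((\<lambda>t. c t p) has_real_derivative f (rot t p)) (at t)" for t p
  proof -
    let ?c = "\<lambda>t. rotated (- \<theta>) x (rotated t (fst p) (snd p))"
    have 1: "((\<lambda>t. \<Phi> (?c t)) has_vector_derivative
        directional K a (?c t) (\<lambda>k. - sin \<theta> * rotated (t + pi / 2) (fst p) (snd p) k)) (at t)"
    proof (rule P(6))
      show "((\<lambda>t. ?c t k) has_real_derivative - sin \<theta> * rotated (t + pi / 2) (fst p) (snd p) k) (at t)" for k
        unfolding rotated_def[of "- \<theta>"]
        by (auto intro!: derivative_eq_intros rotated_deriv)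
    qed
    have "((\<lambda>t. \<Sum>k\<in>K. rotated (t + pi / 2) (fst p) (snd p) k *\<^sub>R b k x) has_vector_derivative
        (\<Sum>k\<in>K. rotated (t + pi / 2 + pi / 2) (fst p) (snd p) k *\<^sub>R b k x)) (at t)"
    proof (rule has_vector_derivative_sum)
      fix k assume "k \<in> K"
      have "((\<lambda>t. rotated (t + pi / 2) (fst p) (snd p) k) has_real_derivative
          rotated (t + pi / 2 + pi / 2) (fst p) (snd p) k) (at t)"
        using rotated_deriv[of "fst p" "snd p" k "t + pi / 2"] by (simp only: DERIV_shift)
      from has_vector_derivative_scaleR[OF this has_vector_derivative_const[of "b k x"]]
      show "((\<lambda>t. rotated (t + pi / 2) (fst p) (snd p) k *\<^sub>R b k x) has_vector_derivative
          rotated (t + pi / 2 + pi / 2) (fst p) (snd p) k *\<^sub>R b k x) (at t)"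
        by simp
    qed
    then have 2: "((\<lambda>t. L (rotated (t + pi / 2) (fst p) (snd p))) has_vector_derivative
        - L (rotated t (fst p) (snd p))) (at t)"
      unfolding L_def directional_linear(2)[symmetric] quarter by (simp add: directional_def)
    show ?thesis
      using has_real_derivative_inner[OF 1 2] unfolding c_def f_def rot_def directional_linear by simp
  qed
  have f_meas [measurable]: "f \<in> borel_measurable (borel \<Otimes>\<^sub>M borel)"
    unfolding f_def by measurable
  have meas: "(\<lambda>(t, p). f (rot t p)) \<in> borel_measurable (borel \<Otimes>\<^sub>M (borel \<Otimes>\<^sub>M borel))"
    unfolding rot_def by measurable
  note pb = poly_bounded_inner directional_poly_bounded P(1,5) pair_size_ge_1 poly_bounded_rotated_fixed
    poly_bounded_compose[OF P(3)] L_pb poly_bounded_scaleR poly_bounded_const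
  have neg: "poly_bounded s (\<lambda>z. - g z)" if "poly_bounded s g" for s :: "'z \<Rightarrow> real" and g :: "'z \<Rightarrow> 'v"
    using that by (rule poly_bounded_mono) simp
  have bound: "poly_bounded (\<lambda>z. pair_size K (snd z)) (\<lambda>z. f (rot (fst z) (snd z)))"
    unfolding f_def rot_def fst_conv snd_conv
    by (intro poly_bounded_add neg pb pair_size_poly_bounded)
  have const: "(\<integral>p. f (rot t p) \<partial>pair) = (\<integral>p. f p \<partial>pair)" for t
    unfolding rot_def by (rule integral_rotated) measurable
  interpret U: prob_space "uniform 0 (2 * pi)" by (rule prob_space_uniform) simp
  have "(\<integral>p. c (2 * pi) p - c 0 p \<partial>pair) = 2 * pi * (\<integral>p. f p \<partial>pair)"
    using expectation_FTC_pair(1)[OF P(1) _ deriv meas bound, of 0 "2 * pi", unfolded const]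
      U.prob_space by simp
  moreover have "c (2 * pi) p - c 0 p = 0" for p
    unfolding c_def rotated_special add_0 by simp
  ultimately have zero: "(\<integral>p. f p \<partial>pair) = 0" by simp
  note ps = pair_size_poly_bounded(1,2)[of K "\<lambda>p. p"]
  have int1: "integrable pair (\<lambda>p. inner (\<Phi> (rotated (- \<theta>) x (fst p))) (L (fst p)))"
    by (rule integrable_tempered_pair[OF P(1)]) (intro pb ps, measurable)
  have int2: "integrable pair (\<lambda>p. inner (directional K a (rotated (- \<theta>) x (fst p)) (snd p)) (L (snd p)))"
    by (rule integrable_tempered_pair[OF P(1)]) (intro pb ps, measurable)
  have self: "poly_bounded (coord_size K) (\<lambda>x. coord_size K x)"
    by (rule poly_bounded_self) (rule order_trans[OF zero_le_one coord_size_ge_1])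
  have int3: "integrable \<mu> (\<lambda>y. inner (\<Phi> (rotated (- \<theta>) x y)) (L y))"
    by (rule integrable_tempered[OF P(1)]) (intro pb coord_size_ge_1 self, measurable)
  have "(\<integral>p. f p \<partial>pair) = - (\<integral>p. inner (\<Phi> (rotated (- \<theta>) x (fst p))) (L (fst p)) \<partial>pair)
      - sin \<theta> * (\<integral>p. inner (directional K a (rotated (- \<theta>) x (fst p)) (snd p)) (L (snd p)) \<partial>pair)"
    unfolding f_def using int1 int2 by simp
  also have "(\<integral>p. inner (\<Phi> (rotated (- \<theta>) x (fst p))) (L (fst p)) \<partial>pair) =
      (\<integral>y. inner (\<Phi> (rotated (- \<theta>) x y)) (L y) \<partial>\<mu>)"
    using int3 by (intro integral_pair_fst[of "\<lambda>y. inner (\<Phi> (rotated (- \<theta>) x y)) (L y)"]) measurable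
  finally show ?thesis using zero by simp
qed

end

section \<open>Powers of the norm\<close>

definition power_field :: "real \<Rightarrow> 'v \<Rightarrow> 'v::real_inner" where
  "power_field q y = (norm y powr (q - 2)) *\<^sub>R y"

text \<open>The case \<open>q = 2\<close> is separate because \<open>0 powr 0 = 0\<close>, whereas the map \<^term>\<open>power_field 2\<close> is the
  identity and has derivative bound \<open>1\<close> at the origin too.\<close>

definition power_weight :: "real \<Rightarrow> 'v::real_inner \<Rightarrow> real" where
  "power_weight q y = (if q = 2 then 1 else norm y powr (q - 2))"

definition power_field_deriv :: "real \<Rightarrow> 'v \<Rightarrow> 'v \<Rightarrow> 'v::real_inner" where
  "power_field_deriv q y z =
    power_weight q y *\<^sub>R z + ((q - 2) * norm y powr (q - 4) * inner y z) *\<^sub>R y"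

text \<open>Away from the origin this is the product rule.  At a zero of \<open>g\<close> and for \<open>q > 2\<close>, the factor
  \<open>norm (g s) powr (q - 2)\<close> tends to \<open>0\<close> while \<open>norm (g s)\<close> is at most a multiple of \<open>\<bar>s - t\<bar>\<close>, so the
  derivative vanishes.\<close>

lemma power_field_has_vector_derivative:
  fixes g :: "real \<Rightarrow> 'v::real_inner"
  assumes q: "2 \<le> q" and g: "(g has_vector_derivative g') (at t)"
  shows "((\<lambda>s. power_field q (g s)) has_vector_derivative power_field_deriv q (g t) g') (at t)"
proof -
  consider "q = 2" | "2 < q" "g t = 0" | "2 < q" "g t \<noteq> 0" using q by linarith
  then show ?thesis
  proof cases
    case 1
    then have "power_field q y = y" "power_field_deriv q y z = z" for y z :: 'v
      by (auto simp: power_field_def power_field_deriv_def power_weight_def)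
    then show ?thesis using g by simp
  next
    case 2
    have zero: "power_field_deriv q (g t) g' = 0"
      using 2 by (simp add: power_field_deriv_def power_weight_def)
    have "((\<lambda>s. norm (g s) powr (q - 2) * (1 + norm g')) \<longlongrightarrow> norm (g t) powr (q - 2) * (1 + norm g')) (at t)"
      using has_vector_derivative_continuous[OF g] 2(1) unfolding isCont_def
      by (intro tendsto_intros tendsto_powr2) auto
    then have lim: "((\<lambda>s. norm (g s) powr (q - 2) * (1 + norm g')) \<longlongrightarrow> 0) (at t)"
      using 2 by simp
    have lip: "eventually (\<lambda>s. norm (g s) \<le> (1 + norm g') * norm (s - t)) (at t)"
    proof -
      have "\<forall>e>0. eventually (\<lambda>s. norm (g s - g t - (s - t) *\<^sub>R g') \<le> e * norm (s - t)) (at t)"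
        using g unfolding has_vector_derivative_def has_derivative_within_alt2 by (rule conjunct2)
      from this[rule_format, OF zero_less_one] show ?thesis
      proof eventually_elim
        case (elim s)
        have "norm (g s) \<le> norm (g s - (s - t) *\<^sub>R g') + norm ((s - t) *\<^sub>R g')"
          using norm_triangle_ineq[of "g s - (s - t) *\<^sub>R g'" "(s - t) *\<^sub>R g'"] by simp
        also have "\<dots> \<le> norm (s - t) + norm (s - t) * norm g'"
          using elim 2 by simp
        finally show ?case by (simp add: algebra_simps)
      qed
    qed
    show ?thesis
      unfolding zero has_vector_derivative_def has_derivative_within_alt2
    proof (intro conjI allI impI)
      fix e :: real assume "e > 0"
      have "eventually (\<lambda>s. norm (g s) powr (q - 2) * (1 + norm g') < e) (at t)"
        by (rule order_tendstoD(2)[OF lim \<open>e > 0\<close>])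
      with lip show "eventually (\<lambda>s. norm (power_field q (g s) - power_field q (g t) - (s - t) *\<^sub>R 0)
          \<le> e * norm (s - t)) (at t)"
      proof eventually_elim
        case (elim s)
        have "norm (power_field q (g s)) = norm (g s) powr (q - 2) * norm (g s)"
          by (simp add: power_field_def)
        also have "\<dots> \<le> norm (g s) powr (q - 2) * ((1 + norm g') * norm (s - t))"
          using elim(1) by (intro mult_left_mono) auto
        also have "\<dots> \<le> e * norm (s - t)"
          unfolding mult.assoc[symmetric] using elim(2) by (intro mult_right_mono) auto
        finally show ?case using 2 by (simp add: power_field_def)
      qed
    qed simp
  next
    case 3
    have n: "((\<lambda>s. norm (g s)) has_real_derivative inner g' (sgn (g t))) (at t)"
    proof -
      have "((\<lambda>s. norm (g s)) has_derivative (\<lambda>h. inner (h *\<^sub>R g') (sgn (g t)))) (at t)"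
        using has_derivative_compose[OF g[unfolded has_vector_derivative_def] has_derivative_norm[OF 3(2)]] .
      then show ?thesis
        unfolding has_field_derivative_def by (rule has_derivative_eq_rhs) (auto simp: mult.commute)
    qed
    have "((\<lambda>s. norm (g s) powr (q - 2)) has_real_derivative
        (q - 2) * norm (g t) powr (q - 2 - 1) * inner g' (sgn (g t))) (at t)"
      using 3(2) by (intro DERIV_chain2[OF has_real_derivative_powr n]) simp
    from has_vector_derivative_scaleR[OF this g]
    have "((\<lambda>s. power_field q (g s)) has_vector_derivative norm (g t) powr (q - 2) *\<^sub>R g' +
        ((q - 2) * norm (g t) powr (q - 2 - 1) * inner g' (sgn (g t))) *\<^sub>R g t) (at t)"
      unfolding power_field_def .
    moreover have "norm (g t) powr (q - 2 - 1) * inner g' (sgn (g t)) = norm (g t) powr (q - 4) * inner (g t) g'"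
      using 3(2) powr_diff[of "norm (g t)" "q - 3" 1]
      by (simp add: sgn_div_norm inner_commute divide_inverse)
    ultimately show ?thesis
      using 3 by (simp add: power_field_deriv_def power_weight_def mult.assoc)
  qed
qed

lemma power_weight_nonneg: "0 \<le> power_weight q y"
  by (simp add: power_weight_def)

lemma power_field_deriv_bound:
  fixes y z :: "'v::real_inner"
  assumes q: "2 \<le> q"
  shows "norm (power_field_deriv q y z) \<le> (q - 1) * power_weight q y * norm z"
proof (cases "y = 0 \<or> q = 2")
  case True
  then show ?thesis
    using q by (auto simp: power_field_deriv_def power_weight_def)
next
  case False
  then have y: "norm y > 0" and w: "power_weight q y = norm y powr (q - 2)"
    by (auto simp: power_weight_def)
  have sq: "norm y powr (q - 4) * (norm y * norm y) = norm y powr (q - 2)"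
    using y powr_add[of "norm y" "q - 4" 2] by (simp add: power2_eq_square)
  have "norm (power_field_deriv q y z) \<le>
      norm y powr (q - 2) * norm z + (q - 2) * norm y powr (q - 4) * \<bar>inner y z\<bar> * norm y"
    unfolding power_field_deriv_def w using q by (intro norm_triangle_le) (simp add: abs_mult)
  also have "\<dots> \<le> norm y powr (q - 2) * norm z + (q - 2) * norm y powr (q - 4) * (norm y * norm z) * norm y"
    using q by (intro add_left_mono mult_right_mono mult_left_mono Cauchy_Schwarz_ineq2) auto
  also have "\<dots> = norm y powr (q - 2) * norm z + (q - 2) * (norm y powr (q - 4) * (norm y * norm y)) * norm z"
    by (simp add: mult_ac)
  also have "\<dots> = (q - 1) * power_weight q y * norm z"
    unfolding sq w by (simp add: algebra_simps)
  finally show ?thesis .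
qed

lemma inner_power_field: "0 < q \<Longrightarrow> inner y (power_field q y) = norm y powr q"
  by (cases "y = 0") (auto simp: power_field_def powr_diff power2_norm_eq_inner[symmetric])

text \<open>Young's inequality with exponents \<open>q / (q - 2)\<close> and \<open>q / 2\<close>.  The factor \<open>q - 1\<close> stays with the
  second variable: then the coefficient of \<open>norm y powr q\<close> is less than \<open>1\<close>, and the final estimate can
  be solved for the \<open>q\<close>-th moment.\<close>

lemma power_weight_young:
  fixes y :: "'v::real_inner"
  assumes q: "2 \<le> q" and s: "0 \<le> s"
  shows "(q - 1) * power_weight q y * s\<^sup>2 \<le>
    (q - 2) / q * norm y powr q + 2 / q * (sqrt (q - 1) * s) powr q"
proof (cases "q = 2")
  case True
  then show ?thesis using s by (simp add: power_weight_def)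
next
  case False
  then have q2: "2 < q" using q by simp
  define p p' where "p = q / (q - 2)" and "p' = q / 2"
  have p: "1 < p" "1 < p'" "1 / p + 1 / p' = 1"
    using q2 by (auto simp: p_def p'_def field_simps)
  have 1: "(norm y powr (q - 2)) powr p = norm y powr q"
    using q2 by (simp add: powr_powr p_def)
  have "(sqrt (q - 1) * s) powr q = ((sqrt (q - 1) * s) powr 2) powr p'"
    by (simp add: powr_powr p'_def)
  also have "(sqrt (q - 1) * s) powr 2 = (q - 1) * s\<^sup>2"
    using q2 s by (simp add: power_mult_distrib)
  finally have 2: "((q - 1) * s\<^sup>2) powr p' = (sqrt (q - 1) * s) powr q" ..
  have "norm y powr (q - 2) * ((q - 1) * s\<^sup>2) \<le>
      (norm y powr (q - 2)) powr p / p + ((q - 1) * s\<^sup>2) powr p' / p'"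
    using q2 by (intro Youngs_inequality p) auto
  then show ?thesis
    unfolding 1 2 using False by (simp add: power_weight_def p_def p'_def mult_ac)
qed

lemma tempered_gradient_power_field:
  fixes \<Phi> :: "('i::countable \<Rightarrow> real) \<Rightarrow> 'v::{real_inner, banach, second_countable_topology}"
  assumes q: "2 \<le> q" and \<Phi>: "tempered_gradient K \<Phi> a"
  shows "tempered_gradient K (\<lambda>x. power_field q (\<Phi> x)) (\<lambda>k x. power_field_deriv q (\<Phi> x) (a k x))"
    and "directional K (\<lambda>k x. power_field_deriv q (\<Phi> x) (a k x)) x u =
      power_field_deriv q (\<Phi> x) (directional K a x u)"
proof -
  note P = tempered_gradientD[OF \<Phi>]
  note [measurable] = P(2,4)
  show dir: "directional K (\<lambda>k x. power_field_deriv q (\<Phi> x) (a k x)) x u =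
      power_field_deriv q (\<Phi> x) (directional K a x u)" for x u
    by (simp add: directional_def power_field_deriv_def scaleR_add_right sum.distrib inner_sum_right
        scaleR_sum_right scaleR_sum_left sum_distrib_left mult_ac)
  have weight: "poly_bounded (coord_size K) (\<lambda>x. power_weight q (\<Phi> x))"
    unfolding power_weight_def using q
    by (cases "q = 2") (auto intro!: poly_bounded_const poly_bounded_powr[OF coord_size_ge_1 P(3)])
  show "tempered_gradient K (\<lambda>x. power_field q (\<Phi> x)) (\<lambda>k x. power_field_deriv q (\<Phi> x) (a k x))"
    unfolding tempered_gradient_def
  proof (intro conjI allI impI ballI)
    show "finite K" by (rule P)
    show "(\<lambda>x. power_field q (\<Phi> x)) \<in> borel_measurable borel"
      unfolding power_field_def by measurable
    show "poly_bounded (coord_size K) (\<lambda>x. power_field q (\<Phi> x))"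
      unfolding power_field_def using q
      by (intro poly_bounded_scaleR poly_bounded_powr coord_size_ge_1 P(3)) auto
    fix k assume k: "k \<in> K"
    have [measurable]: "a k \<in> borel_measurable borel" using k by (rule P)
    show "(\<lambda>x. power_field_deriv q (\<Phi> x) (a k x)) \<in> borel_measurable borel"
      unfolding power_field_deriv_def power_weight_def by measurable
    show "poly_bounded (coord_size K) (\<lambda>x. power_field_deriv q (\<Phi> x) (a k x))"
    proof (rule poly_bounded_mono)
      show "poly_bounded (coord_size K) (\<lambda>x. (q - 1) * power_weight q (\<Phi> x) * norm (a k x))"
        using P(5)[OF k] by (intro poly_bounded_mult poly_bounded_const weight) (simp add: poly_bounded_norm)
      show "norm (power_field_deriv q (\<Phi> x) (a k x)) \<le> norm ((q - 1) * power_weight q (\<Phi> x) * norm (a k x))" for x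
        using power_field_deriv_bound[OF q] q power_weight_nonneg[of q "\<Phi> x"] by (simp add: abs_mult)
    qed
  next
    fix c :: "real \<Rightarrow> 'i \<Rightarrow> real" and c' t
    assume "\<forall>k. ((\<lambda>s. c s k) has_real_derivative c' k) (at t)"
    then show "((\<lambda>s. power_field q (\<Phi> (c s))) has_vector_derivative
        directional K (\<lambda>k x. power_field_deriv q (\<Phi> x) (a k x)) (c t) c') (at t)"
      unfolding dir by (intro power_field_has_vector_derivative[OF q] P(6)) auto
  qed
qed

lemma tempered_gradient_diff_const:
  assumes \<Phi>: "tempered_gradient K \<Phi> a"
  shows "tempered_gradient K (\<lambda>x. \<Phi> x - m) a"
proof -
  note P = tempered_gradientD[OF \<Phi>]
  have "((\<lambda>s. \<Phi> (c s) - m) has_vector_derivative directional K a (c t) c') (at t)"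
    if "\<And>k. ((\<lambda>s. c s k) has_real_derivative c' k) (at t)" for c c' t
    using has_vector_derivative_diff[OF P(6)[OF that] has_vector_derivative_const[of m]] by simp
  then show ?thesis
    unfolding tempered_gradient_def
    using P(1,2,4,5) poly_bounded_diff[OF coord_size_ge_1 P(3) poly_bounded_const] by auto
qed

section \<open>The mean square of the directional derivative\<close>

context rotation_invariant begin

text \<open>For a Gaussian sequence with covariance \<open>h k \<bullet> h l\<close> this is the norm of the sum of the tensors of
  \<open>h k\<close> with the partial derivatives, that is, of the Malliavin derivative.\<close>

definition gradient_norm :: "'i set \<Rightarrow> ('i \<Rightarrow> ('i \<Rightarrow> real) \<Rightarrow> 'v::real_normed_vector) \<Rightarrow> ('i \<Rightarrow> real) \<Rightarrow> real" where
  "gradient_norm K a x = sqrt (\<integral>z. (norm (directional K a x z))\<^sup>2 \<partial>\<mu>)"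

lemma gradient_norm_nonneg [simp]: "0 \<le> gradient_norm K a x"
  by (simp add: gradient_norm_def)

lemma gradient_norm_sq: "(gradient_norm K a x)\<^sup>2 = (\<integral>z. (norm (directional K a x z))\<^sup>2 \<partial>\<mu>)"
  by (simp add: gradient_norm_def)

lemma coord_size_self: "poly_bounded (coord_size K) (\<lambda>x. coord_size K x)"
  by (rule poly_bounded_self) (rule order_trans[OF zero_le_one coord_size_ge_1])

text \<open>The mean is the conditional expectation of \<open>\<Phi> y\<close> given \<open>x\<close>, so Jensen's inequality applies to the
  integral over \<open>y\<close>.\<close>

lemma moment_deviation_le_pair:
  fixes \<Phi> :: "('i \<Rightarrow> real) \<Rightarrow> 'v::{real_inner, banach, second_countable_topology}"
  assumes q: "1 \<le> q" and K: "finite K" and [measurable]: "\<Phi> \<in> borel_measurable borel"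
    and pb: "poly_bounded (coord_size K) \<Phi>"
  defines "m \<equiv> \<integral>y. \<Phi> y \<partial>\<mu>"
  shows "(\<integral>x. norm (\<Phi> x - m) powr q \<partial>\<mu>) \<le> (\<integral>p. norm (\<Phi> (snd p) - \<Phi> (fst p)) powr q \<partial>pair)"
proof -
  let ?f = "\<lambda>p. norm (\<Phi> (snd p) - \<Phi> (fst p)) powr q"
  note ps = pair_size_poly_bounded(1,2)[of K "\<lambda>p. p"]
  have f_int: "integrable pair ?f" using q
    by (intro integrable_tempered_pair[OF K] poly_bounded_powr poly_bounded_diff pair_size_ge_1
          poly_bounded_compose[OF pb] ps) auto
  have \<Phi>_int: "integrable \<mu> \<Phi>"
    by (rule integrable_tempered[OF K pb]) measurable
  have "norm (\<Phi> x - m) powr q \<le> (\<integral>y. ?f (x, y) \<partial>\<mu>)" for x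
  proof -
    have "norm (m - \<Phi> x) = norm (\<integral>y. \<Phi> y - \<Phi> x \<partial>\<mu>)"
      using \<Phi>_int prob_space by (simp add: m_def)
    also have "\<dots> \<le> (\<integral>y. norm (\<Phi> y - \<Phi> x) \<partial>\<mu>)"
      by (rule integral_norm_bound)
    finally have "norm (\<Phi> x - m) powr q \<le> (\<integral>y. norm (\<Phi> y - \<Phi> x) \<partial>\<mu>) powr q"
      using q by (intro powr_mono2) (auto simp: norm_minus_commute)
    also have "\<dots> \<le> (\<integral>y. norm (\<Phi> y - \<Phi> x) powr q \<partial>\<mu>)"
    proof (rule power_mean_ineq[OF q])
      show "integrable \<mu> (\<lambda>y. norm (\<Phi> y - \<Phi> x))" using \<Phi>_int by simp
      show "integrable \<mu> (\<lambda>y. norm (\<Phi> y - \<Phi> x) powr q)" using q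
        by (intro integrable_tempered[OF K] poly_bounded_powr poly_bounded_diff coord_size_ge_1 pb
            poly_bounded_const) auto
    qed simp
    finally show ?thesis by simp
  qed
  then have "(\<integral>x. norm (\<Phi> x - m) powr q \<partial>\<mu>) \<le> (\<integral>x. \<integral>y. ?f (x, y) \<partial>\<mu> \<partial>\<mu>)"
  proof (rule integral_mono[rotated 2])
    show "integrable \<mu> (\<lambda>x. norm (\<Phi> x - m) powr q)"
      using q by (intro integrable_tempered[OF K] poly_bounded_powr poly_bounded_diff
        coord_size_ge_1 pb poly_bounded_const) auto
    show "integrable \<mu> (\<lambda>x. \<integral>y. ?f (x, y) \<partial>\<mu>)"
      by (rule PP.integrable_fst'[OF f_int])
  qed
  then show ?thesis using PP.integral_fst'[OF f_int] by simp
qed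

context
  fixes K and \<Phi> :: "('i \<Rightarrow> real) \<Rightarrow> 'v::{real_inner, banach, second_countable_topology}" and a
  assumes \<Phi>: "tempered_gradient K \<Phi> a"
begin

lemmas tempered = tempered_gradientD[OF \<Phi>]

lemma directional_meas: "f \<in> borel_measurable N \<Longrightarrow> u \<in> borel_measurable N \<Longrightarrow>
    (\<lambda>z. directional K a (f z) (u z)) \<in> borel_measurable N"
  by (rule directional_measurable[OF tempered(4)])

lemma directional_pair_integrable:
  "integrable pair (\<lambda>p. norm (directional K a (fst p) (snd p)) powr r)" if "0 \<le> r" for r
proof (rule integrable_tempered_pair[OF tempered(1)])
  note [measurable] = directional_meas
  show "(\<lambda>p. norm (directional K a (fst p) (snd p)) powr r) \<in> borel_measurable (borel \<Otimes>\<^sub>M borel)"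
    by measurable
  show "poly_bounded (pair_size K) (\<lambda>p. norm (directional K a (fst p) (snd p)) powr r)"
    by (intro poly_bounded_powr directional_poly_bounded pair_size_ge_1 tempered that
        pair_size_poly_bounded(1,2)[of K "\<lambda>p. p"])
qed

lemma directional_moment_integrable: "integrable \<mu> (\<lambda>z. norm (directional K a x z) powr r)" if "0 \<le> r" for r
proof (rule integrable_tempered[OF tempered(1)])
  note [measurable] = directional_meas
  show "(\<lambda>z. norm (directional K a x z) powr r) \<in> borel_measurable borel"
    by measurable
  have "poly_bounded (coord_size K) (\<lambda>z. directional K (\<lambda>k _. a k x) x z)"
    by (intro directional_poly_bounded coord_size_ge_1 tempered poly_bounded_const coord_size_self)
  then show "poly_bounded (coord_size K) (\<lambda>z. norm (directional K a x z) powr r)"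
    by (intro poly_bounded_powr coord_size_ge_1 that) (simp add: directional_def)
qed

lemma gradient_norm_measurable: "gradient_norm K a \<in> borel_measurable borel"
proof -
  note [measurable] = directional_meas
  have "(\<lambda>x. \<integral>z. (norm (directional K a x z))\<^sup>2 \<partial>\<mu>) \<in> borel_measurable borel"
    by (rule borel_measurable_lebesgue_integral) measurable
  then show ?thesis unfolding gradient_norm_def by measurable
qed

lemma gradient_norm_poly_bounded: "poly_bounded (coord_size K) (gradient_norm K a)"
proof -
  have pb: "poly_bounded (pair_size K) (\<lambda>p. (norm (directional K a (fst p) (snd p)))\<^sup>2)"
    by (intro poly_bounded_power poly_bounded_norm[THEN iffD2] directional_poly_bounded pair_size_ge_1 tempered
        pair_size_poly_bounded(1,2)[of K "\<lambda>p. p"])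
  then obtain C n where C: "0 \<le> C"
      "\<And>p. norm ((norm (directional K a (fst p) (snd p)))\<^sup>2) \<le> C * pair_size K p ^ n"
    by (elim poly_boundedE) (rule that, auto)
  define m where "m = (\<integral>z. coord_size K z ^ n \<partial>\<mu>)"
  have m: "0 \<le> m" unfolding m_def
    by (intro integral_nonneg_AE AE_I2 zero_le_power order_trans[OF zero_le_one coord_size_ge_1])
  have sq: "(gradient_norm K a x)\<^sup>2 \<le> (C * m) * coord_size K x ^ n" for x
  proof -
    have "(gradient_norm K a x)\<^sup>2 \<le> (\<integral>z. C * coord_size K x ^ n * coord_size K z ^ n \<partial>\<mu>)"
      unfolding gradient_norm_sq
    proof (rule integral_mono)
      show "integrable \<mu> (\<lambda>z. (norm (directional K a x z))\<^sup>2)"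
        using directional_moment_integrable[of 2 x] by simp
      show "integrable \<mu> (\<lambda>z. C * coord_size K x ^ n * coord_size K z ^ n)"
        using integrable_coord_size_power[OF tempered(1)] by simp
      show "(norm (directional K a x z))\<^sup>2 \<le> C * coord_size K x ^ n * coord_size K z ^ n" for z
        using C(2)[of "(x, z)"] by (simp add: pair_size_def power_mult_distrib mult.assoc)
    qed
    also have "\<dots> = (C * m) * coord_size K x ^ n" by (simp add: m_def)
    finally show ?thesis .
  qed
  have "poly_bounded (coord_size K) (\<lambda>x. (gradient_norm K a x)\<^sup>2)"
    by (rule poly_boundedI[of "C * m"]) (use sq C m in auto)
  from poly_bounded_powr[OF coord_size_ge_1 this, of "1/2"]
  have "poly_bounded (coord_size K) (\<lambda>x. sqrt ((gradient_norm K a x)\<^sup>2))"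
    by (simp add: powr_half_sqrt)
  then show ?thesis by simp
qed

lemma gradient_norm_integrable: "integrable \<mu> (\<lambda>x. gradient_norm K a x powr r)" if "0 \<le> r" for r
proof (rule integrable_tempered[OF tempered(1)])
  note [measurable] = gradient_norm_measurable
  show "(\<lambda>x. gradient_norm K a x powr r) \<in> borel_measurable borel" by measurable
  show "poly_bounded (coord_size K) (\<lambda>x. gradient_norm K a x powr r)"
    using poly_bounded_powr[OF coord_size_ge_1 gradient_norm_poly_bounded that] by simp
qed

section \<open>Exponents at least 2\<close>

text \<open>Integration by parts for fixed \<open>x\<close> produces the product of two directional derivatives in the
  direction of a third copy \<open>z\<close>.  The arithmetic-geometric mean inequality separates them into squares,
  whose integrals over \<open>z\<close> are gradient norms.\<close>

lemma rotated_energy_bound: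
  fixes \<Gamma> :: "('i \<Rightarrow> real) \<Rightarrow> 'v"
  assumes \<Gamma>: "tempered_gradient K \<Gamma> b"
    and \<kappa>: "\<kappa> \<in> borel_measurable borel" "poly_bounded (coord_size K) \<kappa>" "\<And>x. 0 \<le> \<kappa> x"
    and dom: "\<And>x u. norm (directional K b x u) \<le> \<kappa> x * norm (directional K a x u)"
    and \<theta>: "0 \<le> sin \<theta>"
  shows "- (\<integral>p. inner (\<Phi> (rotated (- \<theta>) (fst p) (snd p))) (directional K b (fst p) (snd p)) \<partial>pair) \<le>
    sin \<theta> * (\<integral>p. \<kappa> (fst p) * ((gradient_norm K a (rotated (- \<theta>) (fst p) (snd p)))\<^sup>2
      + (gradient_norm K a (fst p))\<^sup>2) / 2 \<partial>pair)"
proof -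
  note G = tempered_gradientD[OF \<Gamma>]
  note [measurable] = tempered(2) directional_meas \<kappa>(1) gradient_norm_measurable directional_measurable[OF G(4)]
  let ?E = "\<lambda>x. (gradient_norm K a x)\<^sup>2"
  note ps = pair_size_poly_bounded[of K "\<lambda>p. p"]
  define h where "h p = inner (\<Phi> (rotated (- \<theta>) (fst p) (snd p))) (directional K b (fst p) (snd p))" for p
  define w where "w p = \<kappa> (fst p) * (?E (rotated (- \<theta>) (fst p) (snd p)) + ?E (fst p)) / 2" for p
  have Epb: "poly_bounded (coord_size K) ?E"
    by (intro poly_bounded_power gradient_norm_poly_bounded)
  have h_int: "integrable pair h" unfolding h_def
    by (rule integrable_tempered_pair[OF tempered(1)])
       (intro poly_bounded_inner directional_poly_bounded G pair_size_ge_1 ps poly_bounded_compose[OF tempered(3)],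
        measurable)
  have w_eq: "w p = (1/2) * (\<kappa> (fst p) * (?E (rotated (- \<theta>) (fst p) (snd p)) + ?E (fst p)))" for p
    by (simp add: w_def)
  have w_int: "integrable pair w" unfolding w_eq
    by (rule integrable_tempered_pair[OF tempered(1)])
       (intro poly_bounded_mult poly_bounded_add poly_bounded_const pair_size_ge_1 ps
         poly_bounded_compose[OF Epb] poly_bounded_compose[OF \<kappa>(2)],
        measurable)
  have key: "- (\<integral>y. h (x, y) \<partial>\<mu>) \<le> sin \<theta> * (\<integral>y. w (x, y) \<partial>\<mu>)" for x
  proof -
    let ?X = "\<lambda>y. rotated (- \<theta>) x y"
    define l where "l p = inner (directional K a (?X (fst p)) (snd p)) (directional K b x (snd p))" for p
    define r where "r p = \<kappa> x / 2 *
      ((norm (directional K a (?X (fst p)) (snd p)))\<^sup>2 + (norm (directional K a x (snd p)))\<^sup>2)" for p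
    have bx: "directional K b x = directional K (\<lambda>k _. b k x) x"
      and ax: "directional K a x = directional K (\<lambda>k _. a k x) x"
      by (auto simp: directional_def fun_eq_iff)
    have l_int: "integrable pair l"
      unfolding l_def
      by (rule integrable_tempered_pair[OF tempered(1)])
         (subst bx, intro poly_bounded_inner directional_poly_bounded tempered poly_bounded_const
           pair_size_ge_1 ps poly_bounded_rotated_fixed, measurable)
    have r_int: "integrable pair r"
      unfolding r_def
      by (rule integrable_tempered_pair[OF tempered(1)])
         (subst ax, intro poly_bounded_mult poly_bounded_add poly_bounded_power
           poly_bounded_norm[THEN iffD2] directional_poly_bounded tempered poly_bounded_const
           pair_size_ge_1 ps poly_bounded_rotated_fixed, measurable)
    have l_le: "l p \<le> r p" for p
    proof -
      let ?s = "norm (directional K a (?X (fst p)) (snd p))" and ?t = "norm (directional K a x (snd p))"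
      have "l p \<le> ?s * norm (directional K b x (snd p))" unfolding l_def by (rule norm_cauchy_schwarz)
      also have "\<dots> \<le> ?s * (\<kappa> x * ?t)" by (intro mult_left_mono dom) auto
      also have "\<dots> = \<kappa> x / 2 * (2 * ?s * ?t)" by simp
      also have "\<dots> \<le> r p"
        unfolding r_def using \<kappa>(3)[of x] by (intro mult_left_mono sum_squares_bound) auto
      finally show ?thesis .
    qed
    have "- (\<integral>y. h (x, y) \<partial>\<mu>) = sin \<theta> * (\<integral>p. l p \<partial>pair)"
      using integration_by_parts[OF \<Phi>, of \<theta> x b] by (simp add: h_def l_def)
    also have "(\<integral>p. l p \<partial>pair) \<le> (\<integral>p. r p \<partial>pair)"
      using l_int r_int l_le by (rule integral_mono)
    also have "(\<integral>p. r p \<partial>pair) = (\<integral>y. \<integral>z. r (y, z) \<partial>\<mu> \<partial>\<mu>)"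
      by (rule PP.integral_fst'[OF r_int, symmetric])
    also have "\<dots> = (\<integral>y. w (x, y) \<partial>\<mu>)"
    proof (rule Bochner_Integration.integral_cong)
      fix y
      have "integrable \<mu> (\<lambda>z. (norm (directional K a x' z))\<^sup>2)" for x'
        using directional_moment_integrable[of 2 x'] by simp
      then show "(\<integral>z. r (y, z) \<partial>\<mu>) = w (x, y)"
        by (simp add: w_def r_def gradient_norm_sq)
    qed simp
    finally show ?thesis using \<theta> by (auto simp: mult_left_mono)
  qed
  have "- (\<integral>p. h p \<partial>pair) = (\<integral>x. - (\<integral>y. h (x, y) \<partial>\<mu>) \<partial>\<mu>)"
    using PP.integral_fst'[OF h_int] by simp
  also have "\<dots> \<le> (\<integral>x. sin \<theta> * (\<integral>y. w (x, y) \<partial>\<mu>) \<partial>\<mu>)"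
    using PP.integrable_fst'[OF h_int] PP.integrable_fst'[OF w_int] key
    by (intro integral_mono) auto
  also have "\<dots> = sin \<theta> * (\<integral>p. w p \<partial>pair)"
    using PP.integral_fst'[OF w_int] by simp
  finally show ?thesis unfolding h_def w_def .
qed

text \<open>With \<open>\<Gamma> = power_field q \<circ> \<Phi>\<close> the covariance formula has the \<open>q\<close>-th moment \<open>N\<close> of \<open>\<Phi>\<close> on its left.
  After Young's inequality the bound \<open>Z\<close> is the same for each angle, because the rotated copy has the
  law of \<open>x\<close>; what remains is the integral of \<open>sin\<close> over \<open>{0..\<pi> / 2}\<close>, which is \<open>1\<close>.\<close>

theorem poincare_ge_2_centered:
  assumes q: "2 \<le> q" and mean: "(\<integral>x. \<Phi> x \<partial>\<mu>) = 0"
  shows "(\<integral>x. norm (\<Phi> x) powr q \<partial>\<mu>) \<le> sqrt (q - 1) powr q * (\<integral>x. gradient_norm K a x powr q \<partial>\<mu>)"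
proof -
  define b where "b k x = power_field_deriv q (\<Phi> x) (a k x)" for k x
  define \<kappa> where "\<kappa> x = (q - 1) * power_weight q (\<Phi> x)" for x
  define A where "A \<theta> = (\<integral>p. inner (\<Phi> (rotated (- \<theta>) (fst p) (snd p))) (directional K b (fst p) (snd p)) \<partial>pair)" for \<theta>
  define N where "N = (\<integral>x. norm (\<Phi> x) powr q \<partial>\<mu>)"
  define d where "d = (\<integral>x. (sqrt (q - 1) * gradient_norm K a x) powr q \<partial>\<mu>)"
  define Z where "Z = (q - 2) / q * N + 2 / q * d"
  note [measurable] = tempered(2) gradient_norm_measurable
  have \<Gamma>: "tempered_gradient K (\<lambda>x. power_field q (\<Phi> x)) b"
    and dir: "directional K b x u = power_field_deriv q (\<Phi> x) (directional K a x u)" for x u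
    unfolding b_def using tempered_gradient_power_field[OF q \<Phi>] by auto
  have \<kappa>_meas: "\<kappa> \<in> borel_measurable borel"
    unfolding \<kappa>_def power_weight_def by measurable
  have \<kappa>_pb: "poly_bounded (coord_size K) \<kappa>"
    unfolding \<kappa>_def power_weight_def using q
    by (cases "q = 2") (auto intro!: poly_bounded_const poly_bounded_mult poly_bounded_powr[OF coord_size_ge_1 tempered(3)])
  have \<kappa>_nonneg: "0 \<le> \<kappa> x" for x
    using q by (simp add: \<kappa>_def power_weight_nonneg)
  have dom: "norm (directional K b x u) \<le> \<kappa> x * norm (directional K a x u)" for x u
    unfolding dir \<kappa>_def by (rule power_field_deriv_bound[OF q])
  define e where "e x = 2 / q * (sqrt (q - 1) * gradient_norm K a x) powr q" for x
  define n where "n x = (q - 2) / q * norm (\<Phi> x) powr q" for x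
  have young: "\<kappa> x * (gradient_norm K a x')\<^sup>2 \<le> n x + e x'" for x x'
    unfolding \<kappa>_def n_def e_def by (rule power_weight_young[OF q gradient_norm_nonneg])
  have N_int: "integrable \<mu> (\<lambda>x. norm (\<Phi> x) powr q)"
    using q by (intro integrable_tempered[OF tempered(1)] poly_bounded_powr coord_size_ge_1 tempered) auto
  have d_int: "integrable \<mu> (\<lambda>x. (sqrt (q - 1) * gradient_norm K a x) powr q)"
    using q gradient_norm_integrable[of q] by (simp add: powr_mult)
  have [measurable]: "n \<in> borel_measurable borel" "e \<in> borel_measurable borel"
    unfolding n_def e_def by measurable
  have n_int: "integrable \<mu> n" and e_int: "integrable \<mu> e"
    unfolding n_def e_def using N_int d_int by auto
  have ne_sum: "(\<integral>x. n x \<partial>\<mu>) + (\<integral>x. e x \<partial>\<mu>) = Z"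
    unfolding n_def e_def Z_def N_def d_def by simp
  have rot_int: "integrable pair (\<lambda>p. f (rotated \<theta> (fst p) (snd p)))"
    if "poly_bounded (coord_size K) f" and [measurable]: "f \<in> borel_measurable borel" for f :: "_ \<Rightarrow> real" and \<theta>
    by (rule integrable_tempered_pair[OF tempered(1)])
       (intro poly_bounded_compose[OF that(1)] pair_size_poly_bounded[of K "\<lambda>p. p"], measurable)
  have n_pb: "poly_bounded (coord_size K) n"
    unfolding n_def using q
    by (intro poly_bounded_const poly_bounded_mult poly_bounded_powr coord_size_ge_1 tempered(3)) auto
  have "poly_bounded (coord_size K) (\<lambda>x. 2 / q * (sqrt (q - 1) powr q * norm (gradient_norm K a x) powr q))"
    using q by (intro poly_bounded_const poly_bounded_mult poly_bounded_powr coord_size_ge_1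
        gradient_norm_poly_bounded) auto
  then have e_pb: "poly_bounded (coord_size K) e"
    unfolding e_def using q by (simp add: powr_mult)
  have average: "(u + v) / 2 \<le> c + (s + t) / 2" if "u \<le> c + s" "v \<le> c + t" for u c s v t :: real
    using that by (simp add: field_simps)
  have bound: "- A \<theta> \<le> sin \<theta> * Z" if "0 \<le> sin \<theta>" for \<theta>
  proof -
    let ?E = "\<lambda>x. (gradient_norm K a x)\<^sup>2"
    let ?R = "\<lambda>p. rotated (- \<theta>) (fst p) (snd p)"
    have "- A \<theta> \<le> sin \<theta> * (\<integral>p. \<kappa> (fst p) * (?E (?R p) + ?E (fst p)) / 2 \<partial>pair)"
      unfolding A_def by (rule rotated_energy_bound[OF \<Gamma> \<kappa>_meas \<kappa>_pb \<kappa>_nonneg dom that])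
    also have "\<dots> \<le> sin \<theta> * Z"
    proof (rule mult_left_mono[OF _ that])
      have ints: "integrable pair (\<lambda>p. n (fst p))" "integrable pair (\<lambda>p. e (fst p))" "integrable pair (\<lambda>p. e (?R p))"
        using rot_int[OF n_pb, of 0] rot_int[OF e_pb, of 0] rot_int[OF e_pb, of "- \<theta>"]
        by (simp_all add: rotated_special)
      have "(\<integral>p. \<kappa> (fst p) * (?E (?R p) + ?E (fst p)) / 2 \<partial>pair) \<le>
          (\<integral>p. n (fst p) + (e (?R p) + e (fst p)) / 2 \<partial>pair)"
      proof (rule integral_mono)
        have Epb: "poly_bounded (coord_size K) ?E"
          by (intro poly_bounded_power gradient_norm_poly_bounded)
        note [measurable] = \<kappa>_meas
        have "integrable pair (\<lambda>p. (1/2) * (\<kappa> (fst p) * (?E (?R p) + ?E (fst p))))"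
          by (rule integrable_tempered_pair[OF tempered(1)])
             (intro poly_bounded_mult poly_bounded_add poly_bounded_const pair_size_ge_1
               pair_size_poly_bounded[of K "\<lambda>p. p"]
               poly_bounded_compose[OF Epb] poly_bounded_compose[OF \<kappa>_pb], measurable)
        then show "integrable pair (\<lambda>p. \<kappa> (fst p) * (?E (?R p) + ?E (fst p)) / 2)" by simp
        show "integrable pair (\<lambda>p. n (fst p) + (e (?R p) + e (fst p)) / 2)" using ints by simp
        show "\<kappa> (fst p) * (?E (?R p) + ?E (fst p)) / 2 \<le> n (fst p) + (e (?R p) + e (fst p)) / 2" for p
          using young[of "fst p" "?R p"] young[of "fst p" "fst p"]
            average[of "\<kappa> (fst p) * ?E (?R p)" "n (fst p)" "e (?R p)" "\<kappa> (fst p) * ?E (fst p)" "e (fst p)"]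
          unfolding distrib_left by blast
      qed
      also have "\<dots> = (\<integral>p. n (fst p) \<partial>pair) + ((\<integral>p. e (?R p) \<partial>pair) + (\<integral>p. e (fst p) \<partial>pair)) / 2"
        using ints by simp
      also have "\<dots> = Z"
        using ne_sum n_int e_int by (simp add: integral_pair_fst integral_rotated_fst)
      finally show "(\<integral>p. \<kappa> (fst p) * (?E (?R p) + ?E (fst p)) / 2 \<partial>pair) \<le> Z" .
    qed
    finally show ?thesis .
  qed
  interpret U: prob_space "uniform 0 (pi / 2)" by (rule prob_space_uniform) simp
  have sin_int: "integrable (uniform 0 (pi / 2)) sin"
    by (rule U.integrable_const_bound[where B = 1]) auto
  have cos_deriv: "((\<lambda>t. - cos t) has_real_derivative sin t) (at t)" for t :: real
    by (auto intro!: derivative_eq_intros)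
  have sin_avg: "pi / 2 * (\<integral>\<theta>. sin \<theta> \<partial>uniform 0 (pi / 2)) = 1"
    using FTC_uniform[OF _ cos_deriv, of 0 "pi / 2" 1] by simp
  have "N = pi / 2 * (\<integral>\<theta>. - A \<theta> \<partial>uniform 0 (pi / 2))"
    using covariance_rotation(1)[OF \<Phi> \<Gamma>] q mean unfolding A_def N_def by (simp add: inner_power_field)
  also have "\<dots> \<le> pi / 2 * (\<integral>\<theta>. sin \<theta> * Z \<partial>uniform 0 (pi / 2))"
  proof (intro mult_left_mono integral_mono_AE)
    show "integrable (uniform 0 (pi / 2)) (\<lambda>\<theta>. - A \<theta>)"
      using covariance_rotation(2)[OF \<Phi> \<Gamma>] unfolding A_def by simp
    show "integrable (uniform 0 (pi / 2)) (\<lambda>\<theta>. sin \<theta> * Z)" using sin_int by simp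
    show "AE \<theta> in uniform 0 (pi / 2). - A \<theta> \<le> sin \<theta> * Z"
      by (intro AE_uniform_measureI AE_I2 impI bound) (auto intro!: sin_ge_zero)
  qed simp
  also have "\<dots> = Z" using sin_avg by simp
  finally have "N \<le> d"
    using q unfolding Z_def by (simp add: field_simps)
  also have "d = sqrt (q - 1) powr q * (\<integral>x. gradient_norm K a x powr q \<partial>\<mu>)"
    unfolding d_def using q by (simp add: powr_mult)
  finally show ?thesis unfolding N_def .
qed

section \<open>Exponents at most 2\<close>

text \<open>For fixed \<open>x\<close>, moments of order \<open>q \<le> 2\<close> in the direction \<open>z\<close> are dominated by the moment of order \<open>2\<close>,
  which is the square of the gradient norm.\<close>

lemma directional_moment_le:
  assumes q: "0 < q" "q \<le> 2"
  shows "(\<integral>p. norm (directional K a (fst p) (snd p)) powr q \<partial>pair) \<le> (\<integral>x. gradient_norm K a x powr q \<partial>\<mu>)"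
proof -
  let ?f = "\<lambda>p. norm (directional K a (fst p) (snd p)) powr q"
  have f_int: "integrable pair ?f" using q by (intro directional_pair_integrable) auto
  have "(\<integral>z. ?f (x, z) \<partial>\<mu>) \<le> gradient_norm K a x powr q" for x
  proof -
    let ?n = "\<lambda>z. norm (directional K a x z)"
    have "(\<integral>z. ?n z powr q \<partial>\<mu>) powr (2 / q) \<le> (\<integral>z. (?n z powr q) powr (2 / q) \<partial>\<mu>)"
      using q directional_moment_integrable[of q x] directional_moment_integrable[of 2 x]
      by (intro power_mean_ineq) (auto simp: powr_powr)
    also have "\<dots> = (gradient_norm K a x)\<^sup>2"
      using q by (simp add: powr_powr gradient_norm_sq)
    finally have "((\<integral>z. ?n z powr q \<partial>\<mu>) powr (2 / q)) powr (q / 2) \<le> ((gradient_norm K a x)\<^sup>2) powr (q / 2)"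
      using q by (intro powr_mono2) auto
    moreover have "((gradient_norm K a x)\<^sup>2) powr (q / 2) = (gradient_norm K a x powr 2) powr (q / 2)"
      by simp
    ultimately show ?thesis
      using q integral_nonneg_AE[of "\<lambda>z. ?n z powr q" \<mu>] by (simp add: powr_powr del: powr_numeral)
  qed
  then have "(\<integral>x. \<integral>z. ?f (x, z) \<partial>\<mu> \<partial>\<mu>) \<le> (\<integral>x. gradient_norm K a x powr q \<partial>\<mu>)"
    using PP.integrable_fst'[OF f_int] q gradient_norm_integrable[of q]
    by (intro integral_mono) auto
  then show ?thesis using PP.integral_fst'[OF f_int] by simp
qed

text \<open>The path \<open>\<theta> \<mapsto> x\<^sub>\<theta>\<close> joins \<open>x\<close> to \<open>y\<close>.  Jensen's inequality on the interval moves the power inside the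
  average over \<open>\<theta>\<close>, and each angle contributes the same moment by rotation invariance.\<close>

lemma pair_difference_moment_le:
  assumes q: "1 \<le> q"
  shows "(\<integral>p. norm (\<Phi> (snd p) - \<Phi> (fst p)) powr q \<partial>pair) \<le>
    (pi / 2) powr q * (\<integral>p. norm (directional K a (fst p) (snd p)) powr q \<partial>pair)"
proof -
  let ?U = "uniform 0 (pi / 2)"
  interpret U: prob_space ?U by (rule prob_space_uniform) simp
  interpret UP: pair_prob_space ?U pair ..
  note [measurable] = tempered(2) directional_meas
  have SU [measurable_cong]: "sets ?U = sets borel" by simp
  define g where "g \<theta> p = directional K a (rotated \<theta> (fst p) (snd p)) (rotated (\<theta> + pi / 2) (fst p) (snd p))" for \<theta> p
  have g_pb: "poly_bounded (\<lambda>z. pair_size K (snd z)) (\<lambda>z. g (fst z) (snd z))"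
    unfolding g_def by (intro directional_poly_bounded tempered pair_size_ge_1 pair_size_poly_bounded)
  obtain C n where C: "\<And>z. norm (g (fst z) (snd z)) \<le> C * pair_size K (snd z) ^ n"
    using g_pb by (elim poly_boundedE) (rule that, auto)
  have g_le: "norm (g \<theta> p) \<le> C * pair_size K p ^ n" for \<theta> p using C[of "(\<theta>, p)"] by simp
  have gq_pb: "poly_bounded (\<lambda>z. pair_size K (snd z)) (\<lambda>z. norm (g (fst z) (snd z)) powr q)"
    using q by (intro poly_bounded_powr[OF pair_size_ge_1 g_pb]) auto
  obtain C' n' where C': "\<And>z. norm (norm (g (fst z) (snd z)) powr q) \<le> C' * pair_size K (snd z) ^ n'"
    using gq_pb by (elim poly_boundedE) (rule that, auto)
  have gq_le: "norm (g \<theta> p) powr q \<le> C' * pair_size K p ^ n'" for \<theta> p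
    using C'[of "(\<theta>, p)"] by simp
  have g_meas [measurable]: "(\<lambda>(\<theta>, p). g \<theta> p) \<in> borel_measurable (borel \<Otimes>\<^sub>M (borel \<Otimes>\<^sub>M borel))"
    unfolding g_def by measurable
  have g_meas1 [measurable]: "(\<lambda>\<theta>. g \<theta> p) \<in> borel_measurable borel" for p
    unfolding g_def by measurable
  have int: "integrable (?U \<Otimes>\<^sub>M pair) (\<lambda>(\<theta>, p). norm (g \<theta> p) powr q)"
  proof (rule integrable_prob_pair_dominated[OF U.prob_space_axioms PP.prob_space_axioms])
    show "integrable pair (\<lambda>p. C' * pair_size K p ^ n')"
      using integrable_pair_size_power[OF tempered(1)] by simp
    show "(\<lambda>(\<theta>, p). norm (g \<theta> p) powr q) \<in> borel_measurable (?U \<Otimes>\<^sub>M pair)" by measurable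
  qed (use gq_le in auto)
  have path: "norm (\<Phi> (snd p) - \<Phi> (fst p)) powr q \<le> (pi / 2) powr q * (\<integral>\<theta>. norm (g \<theta> p) powr q \<partial>?U)" for p
  proof -
    \<comment> \<open>The fundamental theorem is applied to the component of \<open>\<Phi>\<close> in the direction of the increment,
      which turns a statement about vectors into one about real functions.\<close>
    define e where "e = sgn (\<Phi> (snd p) - \<Phi> (fst p))"
    have e: "norm e \<le> 1" by (simp add: e_def norm_sgn)
    have n_int: "integrable ?U (\<lambda>\<theta>. norm (g \<theta> p))"
      using g_le[of _ p] by (intro U.integrable_const_bound[where B = "C * pair_size K p ^ n"]) auto
    have nq_int: "integrable ?U (\<lambda>\<theta>. norm (g \<theta> p) powr q)"
      using gq_le[of _ p] by (intro U.integrable_const_bound[where B = "C' * pair_size K p ^ n'"]) auto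
    have ge: "\<bar>inner (g \<theta> p) e\<bar> \<le> norm (g \<theta> p)" for \<theta>
      using Cauchy_Schwarz_ineq2[of "g \<theta> p" e] mult_left_mono[OF e, of "norm (g \<theta> p)"] by simp
    have deriv: "((\<lambda>\<theta>. inner (\<Phi> (rotated \<theta> (fst p) (snd p))) e) has_real_derivative inner (g \<theta> p) e) (at \<theta>)" for \<theta>
      using has_real_derivative_inner[OF tempered(6)[of "\<lambda>t. rotated t (fst p) (snd p)", OF rotated_deriv]
          has_vector_derivative_const[of e]] by (simp add: g_def)
    have "norm (\<Phi> (snd p) - \<Phi> (fst p)) = inner (\<Phi> (snd p) - \<Phi> (fst p)) e"
      by (cases "\<Phi> (snd p) = \<Phi> (fst p)")
         (simp_all add: e_def sgn_div_norm power2_norm_eq_inner[symmetric] power2_eq_square)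
    also have "\<dots> = pi / 2 * (\<integral>\<theta>. inner (g \<theta> p) e \<partial>?U)"
      using FTC_uniform[OF _ deriv, of 0 "pi / 2" "C * pair_size K p ^ n"] order_trans[OF ge g_le]
      by (simp add: rotated_special inner_diff_left)
    also have "\<dots> \<le> pi / 2 * (\<integral>\<theta>. norm (g \<theta> p) \<partial>?U)"
    proof (intro mult_left_mono integral_mono n_int)
      show "integrable ?U (\<lambda>\<theta>. inner (g \<theta> p) e)"
        by (rule Bochner_Integration.integrable_bound[OF n_int]) (use ge in auto)
      show "inner (g \<theta> p) e \<le> norm (g \<theta> p)" for \<theta> using ge[of \<theta>] by simp
    qed simp
    finally have "norm (\<Phi> (snd p) - \<Phi> (fst p)) powr q \<le> (pi / 2 * (\<integral>\<theta>. norm (g \<theta> p) \<partial>?U)) powr q"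
      using q by (intro powr_mono2) auto
    also have "\<dots> = (pi / 2) powr q * (\<integral>\<theta>. norm (g \<theta> p) \<partial>?U) powr q"
      by (rule powr_mult)
    also have "\<dots> \<le> (pi / 2) powr q * (\<integral>\<theta>. norm (g \<theta> p) powr q \<partial>?U)"
      using q n_int nq_int by (intro mult_left_mono U.power_mean_ineq) auto
    finally show ?thesis .
  qed
  have rot: "(\<integral>p. norm (g \<theta> p) powr q \<partial>pair) = (\<integral>p. norm (directional K a (fst p) (snd p)) powr q \<partial>pair)" for \<theta>
    unfolding g_def
    using integral_rotated[of "\<lambda>p. norm (directional K a (fst p) (snd p)) powr q" \<theta>] by simp
  have "(\<integral>p. norm (\<Phi> (snd p) - \<Phi> (fst p)) powr q \<partial>pair) \<le>
      (\<integral>p. (pi / 2) powr q * (\<integral>\<theta>. norm (g \<theta> p) powr q \<partial>?U) \<partial>pair)"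
  proof (rule integral_mono[OF _ _ path])
    show "integrable pair (\<lambda>p. norm (\<Phi> (snd p) - \<Phi> (fst p)) powr q)" using q
      by (intro integrable_tempered_pair[OF tempered(1)] poly_bounded_powr poly_bounded_diff pair_size_ge_1
          poly_bounded_compose[OF tempered(3)] pair_size_poly_bounded(1,2)[of K "\<lambda>p. p"]) auto
    show "integrable pair (\<lambda>p. (pi / 2) powr q * (\<integral>\<theta>. norm (g \<theta> p) powr q \<partial>?U))"
      using UP.integrable_snd[OF int] by simp
  qed
  also have "\<dots> = (pi / 2) powr q * (\<integral>\<theta>. \<integral>p. norm (g \<theta> p) powr q \<partial>pair \<partial>?U)"
    using UP.Fubini_integral[OF int] by simp
  also have "\<dots> = (pi / 2) powr q * (\<integral>p. norm (directional K a (fst p) (snd p)) powr q \<partial>pair)"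
    unfolding rot using U.prob_space by simp
  finally show ?thesis .
qed

end

theorem poincare_moment:
  fixes \<Phi> :: "('i \<Rightarrow> real) \<Rightarrow> 'v::{real_inner, banach, second_countable_topology}"
  assumes \<Phi>: "tempered_gradient K \<Phi> a" and q: "1 \<le> q"
  shows "(\<integral>x. norm (\<Phi> x - (\<integral>y. \<Phi> y \<partial>\<mu>)) powr q \<partial>\<mu>) \<le>
    poincare_const q powr q * (\<integral>x. gradient_norm K a x powr q \<partial>\<mu>)"
proof (cases "2 \<le> q")
  case True
  note P = tempered_gradientD[OF \<Phi>]
  have "integrable \<mu> \<Phi>"
    by (rule integrable_tempered[OF P(1,3,2)])
  then have "(\<integral>x. \<Phi> x - (\<integral>y. \<Phi> y \<partial>\<mu>) \<partial>\<mu>) = 0"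
    using prob_space by simp
  from poincare_ge_2_centered[OF tempered_gradient_diff_const[OF \<Phi>] True this] True
  show ?thesis by (simp add: poincare_const_def)
next
  case False
  have "(\<integral>x. norm (\<Phi> x - (\<integral>y. \<Phi> y \<partial>\<mu>)) powr q \<partial>\<mu>) \<le> (\<integral>p. norm (\<Phi> (snd p) - \<Phi> (fst p)) powr q \<partial>pair)"
    by (rule moment_deviation_le_pair[OF q tempered_gradientD(1,2,3)[OF \<Phi>]])
  also have "\<dots> \<le> (pi / 2) powr q * (\<integral>p. norm (directional K a (fst p) (snd p)) powr q \<partial>pair)"
    by (rule pair_difference_moment_le[OF \<Phi> q])
  also have "\<dots> \<le> (pi / 2) powr q * (\<integral>x. gradient_norm K a x powr q \<partial>\<mu>)"
    using q False by (intro mult_left_mono directional_moment_le[OF \<Phi>]) auto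
  finally show ?thesis using False by (simp add: poincare_const_def)
qed

end

section \<open>Smooth functions of finitely many coordinates\<close>

lemma tendsto_coordinatewise:
  fixes f :: "'a \<Rightarrow> 'i \<Rightarrow> 'b::topological_space"
  assumes "\<And>i. ((\<lambda>x. f x i) \<longlongrightarrow> l i) F"
  shows "(f \<longlongrightarrow> l) F"
  using assms limitin_componentwise[of "\<lambda>_::'i. euclidean :: 'b topology" UNIV f l F]
  by (simp add: euclidean_product_topology)

text \<open>The coordinates are released one after the other: the function \<open>w k\<close> follows the curve in the first
  \<open>k\<close> coordinates and stays at time \<open>t\<close> in the others.  Each step is the chain rule for a function of two
  real variables, one of whose partial derivatives is continuous.\<close>

lemma chain_rule_partial_deriv:
  fixes f :: "(nat \<Rightarrow> real) \<Rightarrow> real" and c :: "real \<Rightarrow> nat \<Rightarrow> real"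
  assumes dep: "depends_on_first m f"
    and pd: "\<And>i. i < m \<Longrightarrow> partially_differentiable i f"
    and cont: "\<And>i. i < m \<Longrightarrow> continuous_on UNIV (partial_deriv i f)"
    and c: "\<And>i. ((\<lambda>s. c s i) has_real_derivative c' i) (at t)"
  shows "((\<lambda>s. f (c s)) has_real_derivative (\<Sum>i<m. partial_deriv i f (c t) * c' i)) (at t)"
proof -
  define w where "w k s = (\<lambda>i. if i < k then c s i else c t i)" for k s
  have final: "f (w m s) = f (c s)" for s
    using dep unfolding depends_on_first_def w_def by auto
  have "((\<lambda>s. f (w k s)) has_real_derivative (\<Sum>i<k. partial_deriv i f (c t) * c' i)) (at t)" if "k \<le> m" for k
    using that
  proof (induction k)
    case 0
    then show ?case by (simp add: w_def)
  next
    case (Suc k)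
    then have k: "k < m" by simp
    define G where "G s u = f ((w k s)(k := u))" for s u
    have wt: "(w k t)(k := c t k) = c t" and ws: "(w k s)(k := c t k) = w k s" for s
      by (auto simp: w_def)
    have fx: "((\<lambda>s. G s (c t k)) has_derivative (*) (\<Sum>i<k. partial_deriv i f (c t) * c' i)) (at t within UNIV)"
      using Suc.IH Suc.prems by (simp add: G_def ws has_field_derivative_def)
    have partial: "((\<lambda>u. G s u) has_real_derivative partial_deriv k f ((w k s)(k := u))) (at u)" for s u
    proof -
      let ?x = "(w k s)(k := u)"
      have "(\<lambda>t. f (?x(k := t))) field_differentiable at (?x k)"
        using pd[OF k] unfolding partially_differentiable_def by blast
      then have "((\<lambda>t. f (?x(k := t))) has_real_derivative partial_deriv k f ?x) (at (?x k))"
        unfolding partial_deriv_def by (rule DERIV_deriv_iff_field_differentiable[THEN iffD2])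
      then show ?thesis by (simp add: G_def)
    qed
    have fy: "((\<lambda>u. G s u) has_derivative
        blinfun_apply (blinfun_mult_right (partial_deriv k f ((w k s)(k := u))))) (at u within UNIV)" for s u
      using partial[of s u] by (simp add: has_field_derivative_def)
    have cont_c: "((\<lambda>s. c s i) \<longlongrightarrow> c t i) (at t)" for i
      using DERIV_isCont[OF c[of i]] by (simp add: isCont_def)
    have lim: "((\<lambda>p. (w k (fst p))(k := snd p)) \<longlongrightarrow> c t) (at (t, c t k))"
    proof (rule tendsto_coordinatewise)
      fix i
      have "isCont (\<lambda>s. c s i) t" using c[of i] by (rule DERIV_isCont)
      then have "isCont (\<lambda>p. c (fst p) i) (t, c t k)"
        by (intro isCont_o2[where g = "\<lambda>s. c s i" and f = fst]) auto
      then have 1: "((\<lambda>p. c (fst p) i) \<longlongrightarrow> c t i) (at (t, c t k))"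
        by (simp add: isCont_def)
      have 2: "(snd \<longlongrightarrow> c t k) (at (t, c t k))"
        using tendsto_snd[OF tendsto_ident_at, of "(t, c t k)"] by simp
      show "((\<lambda>p. ((w k (fst p))(k := snd p)) i) \<longlongrightarrow> c t i) (at (t, c t k))"
        using 1 2 by (cases "i = k"; cases "i < k") (auto simp: w_def)
    qed
    have "((\<lambda>p. partial_deriv k f ((w k (fst p))(k := snd p))) \<longlongrightarrow> partial_deriv k f (c t)) (at (t, c t k))"
      by (rule isCont_tendsto_compose[OF _ lim])
         (use cont[OF k] in \<open>simp add: continuous_on_eq_continuous_at\<close>)
    then have "((\<lambda>p. blinfun_mult_right (partial_deriv k f ((w k (fst p))(k := snd p)))) \<longlongrightarrow>
        blinfun_mult_right (partial_deriv k f (c t))) (at (t, c t k))"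
      by (rule bounded_linear.tendsto[OF bounded_linear_blinfun_mult_right])
    then have fy_cont: "continuous (at (t, c t k) within UNIV \<times> UNIV)
        (\<lambda>(s, u). blinfun_mult_right (partial_deriv k f ((w k s)(k := u))))"
      by (simp add: continuous_within split_beta' wt)
    have "((\<lambda>(s, u). G s u) has_derivative
        (\<lambda>(ts, tu). (\<Sum>i<k. partial_deriv i f (c t) * c' i) * ts +
          blinfun_apply (blinfun_mult_right (partial_deriv k f ((w k t)(k := c t k)))) tu))
        (at (t, c t k) within UNIV \<times> UNIV)"
      by (rule has_derivative_partialsI[OF fx fy fy_cont]) auto
    then have G: "((\<lambda>p. G (fst p) (snd p)) has_derivative
        (\<lambda>d. (\<Sum>i<k. partial_deriv i f (c t) * c' i) * fst d + partial_deriv k f (c t) * snd d)) (at (t, c t k))"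
      by (simp add: split_beta' wt)
    have curve: "((\<lambda>s. (s, c s k)) has_derivative (\<lambda>d. (d, c' k * d))) (at t)"
      using c[of k] by (intro has_derivative_Pair has_derivative_ident) (simp add: has_field_derivative_def)
    have "((\<lambda>s. G s (c s k)) has_derivative
        (\<lambda>d. (\<Sum>i<k. partial_deriv i f (c t) * c' i) * d + partial_deriv k f (c t) * (c' k * d))) (at t)"
      using has_derivative_compose[OF curve G] by simp
    moreover have "G s (c s k) = f (w (Suc k) s)" for s
      unfolding G_def by (rule arg_cong[of _ _ f]) (auto simp: w_def less_Suc_eq)
    ultimately have "((\<lambda>s. f (w (Suc k) s)) has_derivative
        (\<lambda>d. (\<Sum>i<k. partial_deriv i f (c t) * c' i) * d + partial_deriv k f (c t) * (c' k * d))) (at t)"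
      by simp
    then show ?case
      unfolding has_field_derivative_def
      by (rule has_derivative_eq_rhs) (auto simp: algebra_simps)
  qed
  from this[OF order_refl] show ?thesis
    by (simp add: final)
qed

lemma smooth_polynomial_growthD:
  assumes "smooth_polynomial_growth m f"
  shows "depends_on_first m f" "continuous_on UNIV f" "polynomial_growth m f"
    "\<And>i. i < m \<Longrightarrow> partially_differentiable i f"
    "\<And>i. i < m \<Longrightarrow> continuous_on UNIV (partial_deriv i f)"
    "\<And>i. i < m \<Longrightarrow> polynomial_growth m (partial_deriv i f)"
proof -
  have s: "smooth_function m f" and g: "\<And>\<alpha>. \<alpha> \<in> lists {..<m} \<Longrightarrow> polynomial_growth m (foldr partial_deriv \<alpha> f)"
    using assms unfolding smooth_polynomial_growth_def by auto
  show "depends_on_first m f" using s unfolding smooth_function_def by auto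
  have s': "continuous_on UNIV (foldr partial_deriv \<alpha> f) \<and>
      (\<forall>i<m. partially_differentiable i (foldr partial_deriv \<alpha> f))" if "\<alpha> \<in> lists {..<m}" for \<alpha>
    using s that unfolding smooth_function_def by blast
  show "continuous_on UNIV f" "polynomial_growth m f" "\<And>i. i < m \<Longrightarrow> partially_differentiable i f"
    using s'[of "[]"] g[of "[]"] by auto
  show "continuous_on UNIV (partial_deriv i f)" "polynomial_growth m (partial_deriv i f)" if "i < m" for i
    using s'[of "[i]"] g[of "[i]"] that by auto
qed

text \<open>The arguments of the several functions in a representation are placed at different positions of one
  sequence; \<open>e\<close> gives these positions.\<close>

lemma polynomial_growth_imp_poly_bounded:
  assumes g: "polynomial_growth m g" and e: "inj_on e {..<m}" "e ` {..<m} \<subseteq> K" and K: "finite K"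
  shows "poly_bounded (coord_size K) (\<lambda>x. g (\<lambda>i. x (e i)))"
proof -
  obtain C k where C: "\<And>x. \<bar>g x\<bar> \<le> C * (1 + L2_set x {..<m}) ^ k"
    using g unfolding polynomial_growth_def by blast
  have C0: "0 \<le> C"
    using C[of "\<lambda>_. 0"] by (simp add: L2_set_def)
  show ?thesis
  proof (rule poly_boundedI[OF C0])
    fix x :: "_ \<Rightarrow> real"
    have "L2_set (\<lambda>i. x (e i)) {..<m} \<le> (\<Sum>i<m. \<bar>x (e i)\<bar>)"
      by (rule L2_set_le_sum_abs)
    also have "\<dots> = (\<Sum>k\<in>e ` {..<m}. \<bar>x k\<bar>)"
      using e(1) by (simp add: sum.reindex)
    also have "\<dots> \<le> (\<Sum>k\<in>K. \<bar>x k\<bar>)"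
      using e(2) K by (intro sum_mono2) auto
    finally have "1 + L2_set (\<lambda>i. x (e i)) {..<m} \<le> coord_size K x"
      by (simp add: coord_size_def)
    then have "C * (1 + L2_set (\<lambda>i. x (e i)) {..<m}) ^ k \<le> C * coord_size K x ^ k"
      using C0 by (intro mult_left_mono power_mono) auto
    then show "norm (g (\<lambda>i. x (e i))) \<le> C * coord_size K x ^ k"
      using C[of "\<lambda>i. x (e i)"] by simp
  qed
qed

section \<open>Gaussian sequences and tensor products\<close>

context hilbert_tensor_product begin

lemma linear_tensor: "linear (\<lambda>h. tensor h v)" "linear (tensor h)"
  using bilinear_tensor unfolding bilinear_def by auto

lemma tensor_sum_left: "tensor (\<Sum>i\<in>A. f i) v = (\<Sum>i\<in>A. tensor (f i) v)"
  by (rule linear_sum[OF linear_tensor(1)])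

lemma tensor_scaleR_left: "tensor (r *\<^sub>R h) v = r *\<^sub>R tensor h v"
  by (rule linear_scale[OF linear_tensor(1)])

lemma tensor_scaleR_right: "tensor h (r *\<^sub>R v) = r *\<^sub>R tensor h v"
  by (rule linear_scale[OF linear_tensor(2)])

lemma norm_sum_tensor_sq:
  "(norm (\<Sum>k\<in>K. tensor (h k) (y k)))\<^sup>2 = (\<Sum>k\<in>K. \<Sum>l\<in>K. inner (h k) (h l) * inner (y k) (y l))"
  by (simp add: power2_norm_eq_inner inner_sum_left inner_sum_right inner_tensor)
     (simp add: inner_commute)

end

lemma Lq_norm_eq:
  assumes "integrable M (\<lambda>\<omega>. norm (G \<omega>) powr q)"
  shows "Lq_norm M q G = ennreal ((\<integral>\<omega>. norm (G \<omega>) powr q \<partial>M) powr (1 / q))"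
  using assms unfolding Lq_norm_def
  by (simp add: nn_integral_eq_integral integral_nonneg_AE)

context isonormal_gaussian_process begin

definition sequence_law :: "(nat \<Rightarrow> 'h) \<Rightarrow> (nat \<Rightarrow> real) measure" where
  "sequence_law h = distr M borel (\<lambda>\<omega> k. W (h k) \<omega>)"

lemma W_sequence_measurable [measurable]:
  fixes h :: "nat \<Rightarrow> 'h"
  shows "(\<lambda>\<omega> k. W (h k) \<omega>) \<in> M \<rightarrow>\<^sub>M borel"
  by (rule measurable_coordinatewise_then_product) measurable

lemma rotation_invariant_sequence_law: "rotation_invariant (sequence_law h)"
proof -
  have p: "prob_space (sequence_law h)"
    unfolding sequence_law_def by (rule prob_space_distr) measurable
  have s: "sets (sequence_law h) = sets borel"
    by (simp add: sequence_law_def)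
  show ?thesis
  proof (intro rotation_invariant.intro rotation_invariant_axioms.intro p s)
    show "integrable (sequence_law h) (\<lambda>x. \<bar>x i\<bar> ^ n)" for i n
      unfolding sequence_law_def
      by (subst integrable_distr_eq) (auto intro: centered_gaussian_integrable_power centered_gaussian_W)
    show "distr (sequence_law h \<Otimes>\<^sub>M sequence_law h) (borel \<Otimes>\<^sub>M borel)
        (\<lambda>(x, y). (rotated \<theta> x y, rotated (\<theta> + pi / 2) x y)) = sequence_law h \<Otimes>\<^sub>M sequence_law h" for \<theta>
    proof (rule rotation_invariant_pair[OF p s])
      fix K :: "nat set" and t :: "nat \<Rightarrow> real" assume K: "finite K"
      have "(CLINT x|sequence_law h. iexp (\<Sum>i\<in>K. t i * x i)) = (CLINT \<omega>|M. iexp (\<Sum>k\<in>K. t k * W (h k) \<omega>))"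
        unfolding sequence_law_def by (subst integral_distr) (auto simp del: of_real_sum)
      then show "(CLINT x|sequence_law h. iexp (\<Sum>i\<in>K. t i * x i)) =
          of_real (exp (- (norm (\<Sum>i\<in>K. t i *\<^sub>R h i))\<^sup>2 / 2))"
        unfolding char_W_combination[OF K] .
    qed
  qed
qed

text \<open>The same double sum is the squared norm of the sum of the tensors \<open>tensor (h k) (y k)\<close>; this
  identifies the gradient norm with the norm of the Malliavin derivative.\<close>

lemma sequence_law_second_moment:
  fixes y :: "nat \<Rightarrow> 'v::{real_inner, banach, second_countable_topology}"
  shows "(\<integral>z. (norm (\<Sum>k\<in>K. z k *\<^sub>R y k))\<^sup>2 \<partial>sequence_law h) =
    (\<Sum>k\<in>K. \<Sum>l\<in>K. inner (h k) (h l) * inner (y k) (y l))"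
proof -
  have "(\<integral>z. (norm (\<Sum>k\<in>K. z k *\<^sub>R y k))\<^sup>2 \<partial>sequence_law h) =
      (\<integral>\<omega>. (\<Sum>k\<in>K. \<Sum>l\<in>K. (W (h k) \<omega> * W (h l) \<omega>) * inner (y k) (y l)) \<partial>M)"
    unfolding sequence_law_def
    by (subst integral_distr)
       (auto simp: power2_norm_eq_inner inner_sum_left inner_sum_right mult_ac sum_distrib_left inner_commute
         intro!: Bochner_Integration.integral_cong)
  also have "\<dots> = (\<Sum>k\<in>K. \<Sum>l\<in>K. inner (h k) (h l) * inner (y k) (y l))"
    by (simp add: integrable_W_mult covariance)
  finally show ?thesis .
qed

end

section \<open>The inequality for smooth random variables\<close>

theorem theorem2p6:
  fixes M :: "'a measure"
    and W :: "'h::{real_inner, banach, second_countable_topology} \<Rightarrow> 'a \<Rightarrow> real"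
    and tensor :: "'h \<Rightarrow> 'v::{real_inner, banach, second_countable_topology}
      \<Rightarrow> 't::{real_inner, banach, second_countable_topology}"
    and F :: "'a \<Rightarrow> 'v" and DF :: "'a \<Rightarrow> 't" and q :: real
  assumes "isonormal_gaussian_process M W"
    and "hilbert_tensor_product tensor"
    and "1 \<le> q"
    and "F \<in> smooth_vector_rv M W"
    and "has_vector_malliavin_derivative tensor M W F DF"
  shows "Lq_norm M q (\<lambda>\<omega>. F \<omega> - integral\<^sup>L M F) \<le> ennreal (poincare_const q) * Lq_norm M q DF"
proof -
  interpret isonormal_gaussian_process M W by fact
  interpret T: hilbert_tensor_product tensor by fact
  note q = assms(3)
  obtain J F' DF' v where FD: "\<And>j. j < J \<Longrightarrow> has_malliavin_derivative M W (F' j) (DF' j)"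
    and F: "\<And>\<omega>. \<omega> \<in> space M \<Longrightarrow> F \<omega> = (\<Sum>j<J::nat. F' j \<omega> *\<^sub>R v j)"
    and DF: "\<And>\<omega>. \<omega> \<in> space M \<Longrightarrow> DF \<omega> = (\<Sum>j<J. tensor (DF' j \<omega>) (v j))"
    using assms(5) unfolding has_vector_malliavin_derivative_def by blast
  define rep where "rep j m h f \<longleftrightarrow> smooth_polynomial_growth m f \<and>
      (\<forall>\<omega>\<in>space M. F' j \<omega> = f (\<lambda>i. W (h i) \<omega>)) \<and>
      (\<forall>\<omega>\<in>space M. DF' j \<omega> = (\<Sum>i<m. partial_deriv i f (\<lambda>i. W (h i) \<omega>) *\<^sub>R h i))"
    for j m h f
  have "\<exists>m h f. rep j m h f" if "j < J" for j
    using FD[OF that] unfolding has_malliavin_derivative_def rep_def by (elim exE conjE) (intro exI conjI)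
  then obtain m h f where rep: "\<And>j. j < J \<Longrightarrow> rep j (m j) (h j) (f j)"
    by metis
  then have sm: "\<And>j. j < J \<Longrightarrow> smooth_polynomial_growth (m j) (f j)"
    and F': "\<And>j \<omega>. j < J \<Longrightarrow> \<omega> \<in> space M \<Longrightarrow> F' j \<omega> = f j (\<lambda>i. W (h j i) \<omega>)"
    and DF': "\<And>j \<omega>. j < J \<Longrightarrow> \<omega> \<in> space M \<Longrightarrow>
        DF' j \<omega> = (\<Sum>i<m j. partial_deriv i (f j) (\<lambda>i. W (h j i) \<omega>) *\<^sub>R h j i)"
    unfolding rep_def by auto
  note S = smooth_polynomial_growthD[OF sm]
  \<comment> \<open>The \<open>i\<close>-th argument of the \<open>j\<close>-th function sits at position \<open>e j i\<close> of a single sequence \<open>g\<close> of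
    vectors.\<close>
  define e where "e j i = prod_encode (j, i)" for j i :: nat
  define g where "g k = (case prod_decode k of (j, i) \<Rightarrow> h j i)" for k
  define \<Phi> where "\<Phi> x = (\<Sum>j<J. f j (\<lambda>i. x (e j i)) *\<^sub>R v j)" for x
  define a where "a k x = (case prod_decode k of (j, i) \<Rightarrow> partial_deriv i (f j) (\<lambda>i. x (e j i)) *\<^sub>R v j)" for k x
  define K where "K = prod_encode ` (SIGMA j:{..<J}. {..<m j})"
  have K: "finite K" by (simp add: K_def)
  have g_e: "g (e j i) = h j i" and a_e: "a (e j i) x = partial_deriv i (f j) (\<lambda>i. x (e j i)) *\<^sub>R v j" for j i x
    by (simp_all add: g_def a_def e_def)
  have sum_K: "(\<Sum>k\<in>K. s k) = (\<Sum>j<J. \<Sum>i<m j. s (e j i))" for s :: "nat \<Rightarrow> 'z::comm_monoid_add"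
    unfolding K_def e_def
    by (subst sum.reindex) (auto simp: sum.Sigma inj_on_def split_beta' intro!: sum.cong)
  have K_E: "\<exists>j<J. \<exists>i<m j. k = e j i" if "k \<in> K" for k
    using that by (auto simp: K_def e_def)
  have inj: "inj_on (e j) {..<m j}" and sub: "j < J \<Longrightarrow> e j ` {..<m j} \<subseteq> K" for j
    by (auto simp: inj_on_def e_def K_def)
  have sect: "(\<lambda>(x :: nat \<Rightarrow> real) i. x (e j i)) \<in> borel_measurable borel" for j
    by (rule measurable_coordinatewise_then_product) measurable
  have sect_meas: "(\<lambda>x. u (\<lambda>i. x (e j i))) \<in> borel_measurable borel" if "continuous_on UNIV u"
    for u :: "(nat \<Rightarrow> real) \<Rightarrow> real" and j
    using measurable_compose[OF sect borel_measurable_continuous_onI[OF that]] .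
  have grad: "tempered_gradient K \<Phi> a"
    unfolding tempered_gradient_def
  proof (intro conjI ballI allI impI K)
    show "\<Phi> \<in> borel_measurable borel"
      unfolding \<Phi>_def
      by (intro borel_measurable_sum borel_measurable_scaleR sect_meas S borel_measurable_const) auto
    show "poly_bounded (coord_size K) \<Phi>"
      unfolding \<Phi>_def
      by (intro poly_bounded_sum coord_size_ge_1 poly_bounded_scaleR poly_bounded_const
          polynomial_growth_imp_poly_bounded[OF _ inj sub K] S) auto
  next
    fix k assume "k \<in> K"
    then obtain j i where ji: "j < J" "i < m j" and k: "k = e j i" using K_E by blast
    have a_eq: "a k = (\<lambda>x. partial_deriv i (f j) (\<lambda>i. x (e j i)) *\<^sub>R v j)" by (simp add: k a_e fun_eq_iff)
    show "a k \<in> borel_measurable borel"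
      unfolding a_eq using ji by (intro borel_measurable_scaleR sect_meas S(5) borel_measurable_const)
    show "poly_bounded (coord_size K) (a k)"
      unfolding a_eq using ji
      by (intro poly_bounded_scaleR poly_bounded_const polynomial_growth_imp_poly_bounded[OF _ inj sub K] S(6))
  next
    fix c :: "real \<Rightarrow> nat \<Rightarrow> real" and c' t
    assume c: "\<forall>k. ((\<lambda>s. c s k) has_real_derivative c' k) (at t)"
    have "((\<lambda>s. \<Phi> (c s)) has_vector_derivative
        (\<Sum>j<J. (\<Sum>i<m j. partial_deriv i (f j) (\<lambda>i. c t (e j i)) * c' (e j i)) *\<^sub>R v j)) (at t)"
      unfolding \<Phi>_def
    proof (rule has_vector_derivative_sum)
      fix j assume j: "j \<in> {..<J}"
      have "((\<lambda>s. f j (\<lambda>i. c s (e j i))) has_real_derivative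
          (\<Sum>i<m j. partial_deriv i (f j) (\<lambda>i. c t (e j i)) * c' (e j i))) (at t)"
        using j c by (intro chain_rule_partial_deriv[where c = "\<lambda>s i. c s (e j i)"] S) auto
      from has_vector_derivative_scaleR[OF this has_vector_derivative_const[of "v j"]]
      show "((\<lambda>s. f j (\<lambda>i. c s (e j i)) *\<^sub>R v j) has_vector_derivative
          (\<Sum>i<m j. partial_deriv i (f j) (\<lambda>i. c t (e j i)) * c' (e j i)) *\<^sub>R v j) (at t)"
        by simp
    qed
    also have "(\<Sum>j<J. (\<Sum>i<m j. partial_deriv i (f j) (\<lambda>i. c t (e j i)) * c' (e j i)) *\<^sub>R v j) =
        directional K a (c t) c'"
      unfolding directional_def sum_K a_e by (simp add: scaleR_sum_left mult.commute)
    finally show "((\<lambda>s. \<Phi> (c s)) has_vector_derivative directional K a (c t) c') (at t)" .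
  qed
  define \<mu> where "\<mu> = sequence_law g"
  define X where "X \<omega> = (\<lambda>k. W (g k) \<omega>)" for \<omega>
  have X [measurable]: "X \<in> M \<rightarrow>\<^sub>M borel" unfolding X_def by measurable
  have \<mu>: "\<mu> = distr M borel X" unfolding \<mu>_def sequence_law_def X_def ..
  interpret R: rotation_invariant \<mu>
    unfolding \<mu>_def by (rule rotation_invariant_sequence_law)
  note P = tempered_gradientD[OF grad]
  note [measurable] = P(2) R.gradient_norm_measurable[OF grad]
  have F_eq: "F \<omega> = \<Phi> (X \<omega>)" if "\<omega> \<in> space M" for \<omega>
    using that by (simp add: F F' \<Phi>_def X_def g_e)
  have DF_eq: "norm (DF \<omega>) = R.gradient_norm K a (X \<omega>)" if \<omega>: "\<omega> \<in> space M" for \<omega>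
  proof -
    have "DF \<omega> = (\<Sum>k\<in>K. tensor (g k) (a k (X \<omega>)))"
      unfolding sum_K g_e a_e using \<omega>
      by (simp add: DF DF' X_def g_e T.tensor_sum_left T.tensor_scaleR_left T.tensor_scaleR_right)
    then have "(norm (DF \<omega>))\<^sup>2 = (R.gradient_norm K a (X \<omega>))\<^sup>2"
      unfolding R.gradient_norm_sq directional_def
      by (simp add: \<mu>_def sequence_law_second_moment T.norm_sum_tensor_sq)
    then show ?thesis by simp
  qed
  have mean: "integral\<^sup>L M F = (\<integral>x. \<Phi> x \<partial>\<mu>)"
    unfolding \<mu> by (subst integral_distr) (auto intro!: Bochner_Integration.integral_cong simp: F_eq)
  define m\<^sub>0 where "m\<^sub>0 = (\<integral>x. \<Phi> x \<partial>\<mu>)"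
  have int1: "integrable \<mu> (\<lambda>x. norm (\<Phi> x - m\<^sub>0) powr q)"
    using q by (intro R.integrable_tempered[OF K] poly_bounded_powr poly_bounded_diff coord_size_ge_1 P
        poly_bounded_const) auto
  have int2: "integrable \<mu> (\<lambda>x. R.gradient_norm K a x powr q)"
    using q by (intro R.gradient_norm_integrable[OF grad]) auto
  have transfer: "integrable M (\<lambda>\<omega>. u (X \<omega>))" "(\<integral>\<omega>. u (X \<omega>) \<partial>M) = (\<integral>x. u x \<partial>\<mu>)"
    if "integrable \<mu> u" "u \<in> borel_measurable borel" for u :: "(nat \<Rightarrow> real) \<Rightarrow> real"
    using that X unfolding \<mu> by (simp_all add: integrable_distr_eq integral_distr)
  have int_F: "integrable M (\<lambda>\<omega>. norm (F \<omega> - integral\<^sup>L M F) powr q)"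
    and F_int: "(\<integral>\<omega>. norm (F \<omega> - integral\<^sup>L M F) powr q \<partial>M) = (\<integral>x. norm (\<Phi> x - m\<^sub>0) powr q \<partial>\<mu>)"
    using transfer[OF int1] unfolding mean m\<^sub>0_def[symmetric]
    by (simp_all add: F_eq cong: Bochner_Integration.integrable_cong Bochner_Integration.integral_cong)
  have int_DF: "integrable M (\<lambda>\<omega>. norm (DF \<omega>) powr q)"
    and DF_int: "(\<integral>\<omega>. norm (DF \<omega>) powr q \<partial>M) = (\<integral>x. R.gradient_norm K a x powr q \<partial>\<mu>)"
    using transfer[OF int2]
    by (simp_all add: DF_eq cong: Bochner_Integration.integrable_cong Bochner_Integration.integral_cong)
  have const: "0 \<le> poincare_const q"
    by (simp add: poincare_const_def)
  have "(\<integral>x. norm (\<Phi> x - m\<^sub>0) powr q \<partial>\<mu>) powr (1 / q) \<le>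
      (poincare_const q powr q * (\<integral>x. R.gradient_norm K a x powr q \<partial>\<mu>)) powr (1 / q)"
    using q R.poincare_moment[OF grad q] unfolding m\<^sub>0_def
    by (intro powr_mono2) (auto intro!: integral_nonneg_AE)
  also have "\<dots> = poincare_const q * (\<integral>x. R.gradient_norm K a x powr q \<partial>\<mu>) powr (1 / q)"
    using q const by (simp add: powr_mult powr_powr)
  finally show ?thesis
    unfolding Lq_norm_eq[OF int_F] Lq_norm_eq[OF int_DF] F_int DF_int
    using const by (simp add: ennreal_leI flip: ennreal_mult)
qed

end
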